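(* Let $\mathcal E$ be a non-normalized seed pattern of rank $n$ on the labeled $n$-regular tree $\mathbb T_n$, with coefficient group $\mathbf P$, ambient semifield $\mathcal F_{>0}$, seeds $(B(t),\mathbf p(t),\mathbf x(t))$ and hatted variables $\hat y_i(t)$. Let $(x_i)=(x_i(t_0))$ be a fixed initial cluster in $\mathcal E$. Let $\overline{\mathbf P}$ be a semifield, and let $\overline{\mathcal F}_{>0}$ be the semifield of subtraction-free rational expressions in algebraically independent elements $\overline x_1,\dots,\overline x_n$ with coefficients in $\overline{\mathbf P}$. Let $\Psi:\mathcal F_{>0}\to\overline{\mathcal F}_{>0}$ be a semifield homomorphism satisfying $\Psi(x_i)\asymp\overline x_i$ for all $i$, i.e. $\Psi(x_i)/\overline x_i\in\overline{\mathbf P}$. Let $c:\mathcal F_{>0}\to\overline{\mathbf P}$ be the composition of semifield homomorphisms $\mathcal F_{>0}\xrightarrow{\Psi}\overline{\mathcal F}_{>0}\to\overline{\mathbf P}$, where the second map specializes every $\overline x_i$ to $1$ and is the identity on $\overline{\mathbf P}$. Then there is a normalized seed pattern $\overline{\mathcal E}$ in $\overline{\mathcal F}_{>0}$, with coefficient semifield $\overline{\mathbf P}$ and seeds $(\overline B(\overline t),\overline{\mathbf p}(\overline t),\overline{\mathbf x}(\overline t))$ indexed by a second copy $\overline{\mathbb T}_n\cong\mathbb T_n$, $t\mapsto\overline t$, of the labeled tree, satisfying for all $t\in\mathbb T_n$ and all $i$ $$\overline B(\overline t)=B(t),\qquad \overline x_i(\overline t)=\frac{\Psi(x_i(t))}{c(x_i(t))},\qquad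 \hat{\overline y}_i(\overline t)=\Psi(\hat y_i(t)),\qquad \overline y_i(\overline t)=c(\hat y_i(t)).$$ Clearly, $\Psi$ is a quasi-homomorphism from $\mathcal E$ to $\overline{\mathcal E}$.
   Context: Notation: $[x]_+=\max(x,0)$; $\mathrm{sign}(x)\in\{-1,0,1\}$. A semifield is an abelian multiplicative group with a commutative, associative addition (written $\oplus$ for coefficient semifields) over which multiplication distributes. The coefficient group $\mathbf P$ is a torsion-free abelian multiplicative group, and the ambient field $\mathcal F$ is a field of rational functions in $n$ variables with coefficients in $\mathbf P$. A non-normalized seed in $\mathcal F$ is a triple $(B,\mathbf p,\mathbf x)$ where $B=(b_{ij})$ is a skew-symmetrizable $n\times n$ integer matrix, $\mathbf p=(p_1^{\pm},\dots,p_n^{\pm})$ consists of $2n$ elements of $\mathbf P$, and the cluster $\mathbf x=(x_1,\dots,x_n)$ is a tuple of algebraically independent elements freely generating $\mathcal F$ over $\mathbb Q\mathbf P$. Seeds $(B,\mathbf p,\mathbf x)$ and $(B',\mathbf p',\mathbf x')$ are related by a mutation in direction $k$ if: $b'_{ij}=-b_{ij}$ if $i=k$ or $j=k$, and $b'_{ij}=b_{ij}+\mathrm{sign}(b_{ik})[b_{ik}b_{kj}]_+$ otherwise; $(p')^{\pm}_k=p_k^{\mp}$, and for $j\ne k$: $(p')_j^+/(p')_j^-=(p_j^+/p_j^-)(p_k^+)^{b_{kj}}$ if $b_{kj}\ge0$, and $=(p_j^+/p_j^-)(p_k^-)^{b_{kj}}$ if $b_{kj}\le0$; $x'_j=x_j$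 for $j\ne k$ and $x_kx'_k=p_k^+\prod_j x_j^{[b_{jk}]_+}+p_k^-\prod_j x_j^{[-b_{jk}]_+}$. A labeled $n$-regular tree $\mathbb T_n$ has the edges at each vertex labeled $1,\dots,n$. A non-normalized seed pattern is a family of non-normalized seeds $\Sigma(t)$, $t\in\mathbb T_n$, such that seeds at vertices joined by an edge labeled $k$ are related by a mutation in direction $k$. Its ambient semifield $\mathcal F_{>0}\subset\mathcal F$ is the set of elements expressible from a cluster and elements of $\mathbf P$ using only $+,\times,\div$ (independent of the cluster). The hatted variables are $\hat y_j(t)=\frac{p_j^+(t)}{p_j^-(t)}\prod_i x_i(t)^{b_{ij}(t)}$. A seed pattern is normalized if its coefficient group is a semifield (with addition $\oplus$) and $p_j^+(t)\oplus p_j^-(t)=1$ for all $j,t$. Then one sets $y_j(t)=p_j^+(t)/p_j^-(t)$, which determines $p_j^+(t)=y_j(t)/(1\oplus y_j(t))$ and $p_j^-(t)=1/(1\oplus y_j(t))$. Seed equivalence: $\Sigma\sim\Sigma^*$ if $\Sigma^*$ is obtained from $\Sigma$ by a sequence of mutations of non-normalized seeds whose sequence of directions is contractible, i.e. describes a walk in $\mathbb T_n$ starting and ending at the same vertex. For $n\ge2$ this is equivalent to: $B=B^*$ and there are elements $c_j,d_j$ of the coefficient group with $x_j^*=x_j/c_j$ and $(p^* )_j^{\pm}=\frac{p_j^{\pm}}{d_j}\prod_i c_i^{[\pm b_{ij}]_+}$. A quasi-homomorphism from $\mathcal E$ to $\overline{\mathcal E}$ is a semifield homomorphism $\Psi:\mathcal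 F_{>0}\to\overline{\mathcal F}_{>0}$ with $\Psi(\mathbf P)\subset\overline{\mathbf P}$ such that $(B(t),\Psi(\mathbf p(t)),\Psi(\mathbf x(t)))\sim\overline\Sigma(\overline t)$ for all $t$, for an isomorphism $t\mapsto\overline t$ of the labeled trees.
   Formalization: Assumes Ψ(P) ⊂ P̄, which the definition of quasi-homomorphism requires and without which the claim fails; in rank n = 1, where seed equivalence is mere equality, the quasi-homomorphism claim uses the explicit rescaling relation by elements c_j, d_j instead. *)

theory Defs
  imports
    Complex_Main
    "HOL-Library.Poly_Mapping"
    "HOL-Analysis.Finite_Cartesian_Product"
begin

section \<open>Groups and semifields inside an ambient field\<close>

text \<open>
  Coefficient groups and semifields are represented as subsets of the ambient field
  \<^typ>\<open>'f\<close>, with the multiplication of that field. The addition of a semifield is a separate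
  argument: for a coefficient semifield it is the auxiliary addition and not the addition of the
  field; for an ambient semifield it is \<^term>\<open>(+)\<close>.
\<close>

definition mult_group :: "'f::field set \<Rightarrow> bool" where
  "mult_group S \<longleftrightarrow>
     1 \<in> S \<and> 0 \<notin> S \<and> (\<forall>a\<in>S. \<forall>b\<in>S. a * b \<in> S) \<and> (\<forall>a\<in>S. inverse a \<in> S)"

definition semifield :: "'f::field set \<Rightarrow> ('f \<Rightarrow> 'f \<Rightarrow> 'f) \<Rightarrow> bool" where
  "semifield S add \<longleftrightarrow>
     mult_group S \<and>
     (\<forall>a\<in>S. \<forall>b\<in>S. add a b \<in> S) \<and>
     (\<forall>a\<in>S. \<forall>b\<in>S. add a b = add b a) \<and>
     (\<forall>a\<in>S. \<forall>b\<in>S. \<forall>c\<in>S. add (add a b) c = add a (add b c)) \<and>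
     (\<forall>a\<in>S. \<forall>b\<in>S. \<forall>c\<in>S. a * add b c = add (a * b) (a * c))"

definition semifield_hom ::
  "'f::field set \<Rightarrow> ('f \<Rightarrow> 'f \<Rightarrow> 'f) \<Rightarrow> 'g::field set \<Rightarrow> ('g \<Rightarrow> 'g \<Rightarrow> 'g) \<Rightarrow> ('f \<Rightarrow> 'g) \<Rightarrow> bool" where
  "semifield_hom S add S' add' h \<longleftrightarrow>
     h ` S \<subseteq> S' \<and>
     (\<forall>a\<in>S. \<forall>b\<in>S. h (a * b) = h a * h b) \<and>
     (\<forall>a\<in>S. \<forall>b\<in>S. h (add a b) = add' (h a) (h b))"

abbreviation rat_scale :: "rat \<Rightarrow> 'f::field_char_0 \<Rightarrow> 'f" where
  "rat_scale r x \<equiv> of_rat r * x"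

text \<open>
  Rational linear independence of \<open>P\<close> says that the subring of the ambient field spanned by \<open>P\<close> is
  the group ring \<open>\<rat>P\<close>.
\<close>

definition coefficient_group :: "'f::field_char_0 set \<Rightarrow> bool" where
  "coefficient_group P \<longleftrightarrow>
     mult_group P \<and>
     (\<forall>p\<in>P. \<forall>m>0. p ^ m = 1 \<longrightarrow> p = 1) \<and>
     \<not> module.dependent rat_scale P"

abbreviation group_ring :: "'f::field_char_0 set \<Rightarrow> 'f set" where
  "group_ring P \<equiv> module.span rat_scale P"


section \<open>Free generators\<close>

text \<open>Polynomials in variables indexed by \<^typ>\<open>'n\<close> map exponent vectors to coefficients.\<close>

definition poly_eval :: "(('n::finite \<Rightarrow>\<^sub>0 nat) \<Rightarrow>\<^sub>0 'f::field) \<Rightarrow> ('n \<Rightarrow> 'f) \<Rightarrow> 'f" where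
  "poly_eval f x =
     (\<Sum>m\<in>Poly_Mapping.keys f.
        Poly_Mapping.lookup f m * (\<Prod>i\<in>UNIV. x i ^ Poly_Mapping.lookup m i))"

definition algebraically_independent :: "'f::field set \<Rightarrow> ('n::finite \<Rightarrow> 'f) \<Rightarrow> bool" where
  "algebraically_independent R x \<longleftrightarrow>
     (\<forall>f. range (Poly_Mapping.lookup f) \<subseteq> R \<and> poly_eval f x = 0 \<longrightarrow> f = 0)"

inductive_set generated_field :: "'f::field set \<Rightarrow> 'f set" for A where
  base: "a \<in> A \<Longrightarrow> a \<in> generated_field A"
| one: "1 \<in> generated_field A"
| diff: "a \<in> generated_field A \<Longrightarrow> b \<in> generated_field A \<Longrightarrow> a - b \<in> generated_field A"
| mult: "a \<in> generated_field A \<Longrightarrow> b \<in> generated_field A \<Longrightarrow> a * b \<in> generated_field A"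
| inv: "a \<in> generated_field A \<Longrightarrow> inverse a \<in> generated_field A"

text \<open>
  If \<open>freely_generates P x\<close>, the ambient field is the field of rational functions in the \<open>x i\<close>
  with coefficients in \<open>P\<close>, i.e. the fraction field of the polynomial ring \<open>\<rat>P[x]\<close>.
\<close>

definition freely_generates :: "'f::field_char_0 set \<Rightarrow> ('n::finite \<Rightarrow> 'f) \<Rightarrow> bool" where
  "freely_generates P x \<longleftrightarrow>
     algebraically_independent (group_ring P) x \<and> generated_field (P \<union> range x) = UNIV"

inductive_set subtraction_free :: "'f::field set \<Rightarrow> ('n \<Rightarrow> 'f) \<Rightarrow> 'f set" for P x where
  coeff: "p \<in> P \<Longrightarrow> p \<in> subtraction_free P x"
| var: "x i \<in> subtraction_free P x"
| add: "a \<in> subtraction_free P x \<Longrightarrow> b \<in> subtraction_free P x \<Longrightarrow> a + b \<in> subtraction_free P x"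
| mult: "a \<in> subtraction_free P x \<Longrightarrow> b \<in> subtraction_free P x \<Longrightarrow> a * b \<in> subtraction_free P x"
| div: "a \<in> subtraction_free P x \<Longrightarrow> b \<in> subtraction_free P x \<Longrightarrow> a / b \<in> subtraction_free P x"

text \<open>
  The values of a specialization on \<^term>\<open>subtraction_free P x\<close> are uniquely determined; only
  these values matter, so outside of that set the choice operator may return anything.
\<close>

definition is_specialization ::
  "'f::field set \<Rightarrow> ('f \<Rightarrow> 'f \<Rightarrow> 'f) \<Rightarrow> ('n \<Rightarrow> 'f) \<Rightarrow> ('f \<Rightarrow> 'f) \<Rightarrow> bool" where
  "is_specialization P add x s \<longleftrightarrow>
     semifield_hom (subtraction_free P x) (+) P add s \<and>
     (\<forall>i. s (x i) = 1) \<and> (\<forall>p\<in>P. s p = p)"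

definition specialization ::
  "'f::field set \<Rightarrow> ('f \<Rightarrow> 'f \<Rightarrow> 'f) \<Rightarrow> ('n \<Rightarrow> 'f) \<Rightarrow> 'f \<Rightarrow> 'f" where
  "specialization P add x = (SOME s. is_specialization P add x s)"


section \<open>The labeled regular tree\<close>

text \<open>
  \<open>T t k t'\<close> says that \<open>t\<close> and \<open>t'\<close> are joined by an edge labeled \<open>k\<close>. The vertices are all elements
  of \<^typ>\<open>'t\<close>, the labels are all elements of the finite type \<^typ>\<open>'n\<close>, and the degree \<open>n\<close> of the
  tree is the cardinality of \<^typ>\<open>'n\<close>.
\<close>

definition tree_path :: "('t \<Rightarrow> 'n \<Rightarrow> 't \<Rightarrow> bool) \<Rightarrow> 't \<Rightarrow> 't list \<Rightarrow> 't \<Rightarrow> bool" where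
  "tree_path T u ts v \<longleftrightarrow>
     ts \<noteq> [] \<and> hd ts = u \<and> last ts = v \<and> distinct ts \<and> successively (\<lambda>s s'. \<exists>k. T s k s') ts"

definition labeled_regular_tree :: "('t \<Rightarrow> 'n::finite \<Rightarrow> 't \<Rightarrow> bool) \<Rightarrow> bool" where
  "labeled_regular_tree T \<longleftrightarrow>
     (\<forall>t k t'. T t k t' \<longrightarrow> T t' k t) \<and>
     (\<forall>t k. \<not> T t k t) \<and>
     (\<forall>t k k' t'. T t k t' \<and> T t k' t' \<longrightarrow> k = k') \<and>
     (\<forall>t k. \<exists>!t'. T t k t') \<and>
     (\<forall>u v. \<exists>!ts. tree_path T u ts v)"

definition labeled_tree_iso ::
  "('t \<Rightarrow> 'n \<Rightarrow> 't \<Rightarrow> bool) \<Rightarrow> ('s \<Rightarrow> 'n \<Rightarrow> 's \<Rightarrow> bool) \<Rightarrow> ('t \<Rightarrow> 's) \<Rightarrow> bool" where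
  "labeled_tree_iso T T' h \<longleftrightarrow> bij h \<and> (\<forall>t k t'. T t k t' \<longleftrightarrow> T' (h t) k (h t'))"

fun tree_walk :: "('t \<Rightarrow> 'n \<Rightarrow> 't \<Rightarrow> bool) \<Rightarrow> 't \<Rightarrow> 'n list \<Rightarrow> 't \<Rightarrow> bool" where
  "tree_walk T t [] t' \<longleftrightarrow> t = t'"
| "tree_walk T t (k # ks) t' \<longleftrightarrow> (\<exists>s. T t k s \<and> tree_walk T s ks t')"

definition contractible :: "('t \<Rightarrow> 'n \<Rightarrow> 't \<Rightarrow> bool) \<Rightarrow> 'n list \<Rightarrow> bool" where
  "contractible T ks \<longleftrightarrow> (\<exists>t. tree_walk T t ks t)"


section \<open>Non-normalized seeds and mutation\<close>

record ('n::finite, 'f) seed =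
  exmat :: "int ^ 'n ^ 'n"
  pplus :: "'n \<Rightarrow> 'f"
  pminus :: "'n \<Rightarrow> 'f"
  cluster :: "'n \<Rightarrow> 'f"

definition skew_symmetrizable :: "int ^ 'n::finite ^ 'n \<Rightarrow> bool" where
  "skew_symmetrizable B \<longleftrightarrow>
     (\<exists>d :: 'n \<Rightarrow> int. (\<forall>i. d i > 0) \<and> (\<forall>i j. d i * B $ i $ j = - (d j * B $ j $ i)))"

definition nn_seed :: "'f::field_char_0 set \<Rightarrow> ('n::finite, 'f) seed \<Rightarrow> bool" where
  "nn_seed P S \<longleftrightarrow>
     skew_symmetrizable (exmat S) \<and>
     (\<forall>j. pplus S j \<in> P \<and> pminus S j \<in> P) \<and>
     freely_generates P (cluster S)"

definition mutation ::
  "'f::field_char_0 set \<Rightarrow> 'n::finite \<Rightarrow> ('n, 'f) seed \<Rightarrow> ('n, 'f) seed \<Rightarrow> bool" where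
  "mutation P k S S' \<longleftrightarrow>
     nn_seed P S \<and> nn_seed P S' \<and>
     (\<forall>i j. exmat S' $ i $ j =
        (if i = k \<or> j = k then - exmat S $ i $ j
         else exmat S $ i $ j
              + sgn (exmat S $ i $ k) * max (exmat S $ i $ k * exmat S $ k $ j) 0)) \<and>
     pplus S' k = pminus S k \<and> pminus S' k = pplus S k \<and>
     (\<forall>j. j \<noteq> k \<longrightarrow>
        pplus S' j / pminus S' j =
          pplus S j / pminus S j *
          (if exmat S $ k $ j \<ge> 0 then pplus S k else pminus S k) powi (exmat S $ k $ j)) \<and>
     (\<forall>j. j \<noteq> k \<longrightarrow> cluster S' j = cluster S j) \<and>
     cluster S k * cluster S' k =
       pplus S k * (\<Prod>j\<in>UNIV. cluster S j powi max (exmat S $ j $ k) 0) +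
       pminus S k * (\<Prod>j\<in>UNIV. cluster S j powi max (- exmat S $ j $ k) 0)"

definition yhat :: "('n::finite, 'f::field) seed \<Rightarrow> 'n \<Rightarrow> 'f" where
  "yhat S j = pplus S j / pminus S j * (\<Prod>i\<in>UNIV. cluster S i powi (exmat S $ i $ j))"

definition ycoeff :: "('n::finite, 'f::field) seed \<Rightarrow> 'n \<Rightarrow> 'f" where
  "ycoeff S j = pplus S j / pminus S j"


section \<open>Seed patterns\<close>

definition nn_seed_pattern ::
  "('t \<Rightarrow> 'n::finite \<Rightarrow> 't \<Rightarrow> bool) \<Rightarrow> 'f::field_char_0 set \<Rightarrow> ('t \<Rightarrow> ('n, 'f) seed) \<Rightarrow> bool" where
  "nn_seed_pattern T P \<Sigma> \<longleftrightarrow>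
     labeled_regular_tree T \<and> coefficient_group P \<and>
     (\<forall>t. nn_seed P (\<Sigma> t)) \<and>
     (\<forall>t k t'. T t k t' \<longrightarrow> mutation P k (\<Sigma> t) (\<Sigma> t'))"

definition normalized_seed_pattern ::
  "('t \<Rightarrow> 'n::finite \<Rightarrow> 't \<Rightarrow> bool) \<Rightarrow> 'f::field_char_0 set \<Rightarrow> ('f \<Rightarrow> 'f \<Rightarrow> 'f) \<Rightarrow>
   ('t \<Rightarrow> ('n, 'f) seed) \<Rightarrow> bool" where
  "normalized_seed_pattern T P add \<Sigma> \<longleftrightarrow>
     nn_seed_pattern T P \<Sigma> \<and> semifield P add \<and>
     (\<forall>t j. add (pplus (\<Sigma> t) j) (pminus (\<Sigma> t) j) = 1)"

text \<open>In a seed pattern all members of the following union coincide.\<close>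

definition ambient_semifield :: "'f::field set \<Rightarrow> ('t \<Rightarrow> ('n::finite, 'f) seed) \<Rightarrow> 'f set" where
  "ambient_semifield P \<Sigma> = (\<Union>t. subtraction_free P (cluster (\<Sigma> t)))"


section \<open>Seed equivalence and quasi-homomorphisms\<close>

fun mutation_sequence ::
  "'f::field_char_0 set \<Rightarrow> 'n::finite list \<Rightarrow> ('n, 'f) seed \<Rightarrow> ('n, 'f) seed \<Rightarrow> bool" where
  "mutation_sequence P [] S S' \<longleftrightarrow> nn_seed P S \<and> S' = S"
| "mutation_sequence P (k # ks) S S' \<longleftrightarrow>
     (\<exists>S1. mutation P k S S1 \<and> mutation_sequence P ks S1 S')"

text \<open>
  A mutation determines the coefficients of the new seed only up to rescaling, so a contractible
  sequence of mutations need not lead back to the seed it starts from.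
\<close>

definition seed_equiv ::
  "('t \<Rightarrow> 'n::finite \<Rightarrow> 't \<Rightarrow> bool) \<Rightarrow> 'f::field_char_0 set \<Rightarrow>
   ('n, 'f) seed \<Rightarrow> ('n, 'f) seed \<Rightarrow> bool" where
  "seed_equiv T P S S' \<longleftrightarrow> (\<exists>ks. contractible T ks \<and> mutation_sequence P ks S S')"

text \<open>
  In rank at least 2, \<^term>\<open>seed_rescaling P\<close> is the same relation as \<^term>\<open>seed_equiv T P\<close>. In rank 1
  there are no coefficients left to rescale, so \<^term>\<open>seed_equiv T P\<close> degenerates to equality while
  \<^term>\<open>seed_rescaling P\<close> does not.
\<close>

definition seed_rescaling ::
  "'f::field_char_0 set \<Rightarrow> ('n::finite, 'f) seed \<Rightarrow> ('n, 'f) seed \<Rightarrow> bool" where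
  "seed_rescaling P S S' \<longleftrightarrow>
     nn_seed P S \<and> nn_seed P S' \<and> exmat S' = exmat S \<and>
     (\<exists>c d. range c \<subseteq> P \<and> range d \<subseteq> P \<and>
        (\<forall>j. cluster S' j = cluster S j / c j) \<and>
        (\<forall>j. pplus S' j =
               pplus S j / d j * (\<Prod>i\<in>UNIV. c i powi max (exmat S $ i $ j) 0)) \<and>
        (\<forall>j. pminus S' j =
               pminus S j / d j * (\<Prod>i\<in>UNIV. c i powi max (- exmat S $ i $ j) 0)))"

definition map_seed :: "('f \<Rightarrow> 'g) \<Rightarrow> ('n::finite, 'f) seed \<Rightarrow> ('n, 'g) seed" where
  "map_seed h S =
     \<lparr>exmat = exmat S, pplus = h \<circ> pplus S, pminus = h \<circ> pminus S, cluster = h \<circ> cluster S\<rparr>"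

definition quasi_homomorphism_wrt ::
  "(('n::finite, 'g::field_char_0) seed \<Rightarrow> ('n, 'g) seed \<Rightarrow> bool) \<Rightarrow>
   ('t \<Rightarrow> 'n \<Rightarrow> 't \<Rightarrow> bool) \<Rightarrow> 'f::field_char_0 set \<Rightarrow> ('t \<Rightarrow> ('n, 'f) seed) \<Rightarrow>
   ('s \<Rightarrow> 'n \<Rightarrow> 's \<Rightarrow> bool) \<Rightarrow> 'g set \<Rightarrow> ('s \<Rightarrow> ('n, 'g) seed) \<Rightarrow>
   ('t \<Rightarrow> 's) \<Rightarrow> ('f \<Rightarrow> 'g) \<Rightarrow> bool" where
  "quasi_homomorphism_wrt R T P \<Sigma> T' P' \<Sigma>' bar \<Psi> \<longleftrightarrow>
     labeled_tree_iso T T' bar \<and>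
     semifield_hom (ambient_semifield P \<Sigma>) (+) (ambient_semifield P' \<Sigma>') (+) \<Psi> \<and>
     \<Psi> ` P \<subseteq> P' \<and>
     (\<forall>t. R (map_seed \<Psi> (\<Sigma> t)) (\<Sigma>' (bar t)))"

definition quasi_homomorphism ::
  "('t \<Rightarrow> 'n::finite \<Rightarrow> 't \<Rightarrow> bool) \<Rightarrow> 'f::field_char_0 set \<Rightarrow> ('t \<Rightarrow> ('n, 'f) seed) \<Rightarrow>
   ('s \<Rightarrow> 'n \<Rightarrow> 's \<Rightarrow> bool) \<Rightarrow> 'g::field_char_0 set \<Rightarrow> ('s \<Rightarrow> ('n, 'g) seed) \<Rightarrow>
   ('t \<Rightarrow> 's) \<Rightarrow> ('f \<Rightarrow> 'g) \<Rightarrow> bool" where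
  "quasi_homomorphism T P \<Sigma> T' P' \<Sigma>' bar \<Psi> \<longleftrightarrow>
     quasi_homomorphism_wrt (seed_equiv T' P') T P \<Sigma> T' P' \<Sigma>' bar \<Psi>"

end

theory Submission
  imports Defs "HOL-Library.Multiset"
begin

text \<open>
  Put \<open>\<Sigma>bar (bar t)\<close> to be the seed with cluster \<open>\<Psi> x\<^sub>i / c x\<^sub>i\<close> and coefficients
  \<open>p\<^sub>j\<^sup>+ = c (yhat\<^sub>j / (1 + yhat\<^sub>j))\<close> and \<open>p\<^sub>j\<^sup>- = c (1 / (1 + yhat\<^sub>j))\<close>. Since \<open>c\<close> turns \<open>+\<close> into \<open>oplus\<close>, it is
  normalized. Applying \<open>c\<close> to the mutation rule of the \<open>yhat\<^sub>j\<close> gives the mutation rule of the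
  coefficients, and dividing the image of an exchange relation under \<open>\<Psi>\<close> by its image under \<open>c\<close>
  gives the new exchange relation. At \<open>t0\<close> the cluster is \<open>xbar\<close>, and mutations preserve free
  generation, so these are seeds at every vertex.

  The specialization underlying \<open>c\<close> exists because a subtraction-free expression is a quotient of
  nonempty sums of terms, and the terms of such a sum are determined by its value.

  The seeds \<open>\<Psi> (\<Sigma> t)\<close> and \<open>\<Sigma>bar (bar t)\<close> differ by a rescaling. In rank at least 2 a rescaling
  is realized by mutating along closed walks: mutating twice in direction \<open>k\<close> rescales the
  coefficients with index other than \<open>k\<close>, and rescaling the coefficients with index \<open>k\<close> in between
  rescales \<open>x\<^sub>k\<close>.
\<close>

section \<open>Polynomials and algebraic independence\<close>

definition monomial :: "('n::finite \<Rightarrow> 'f::field) \<Rightarrow> ('n \<Rightarrow>\<^sub>0 nat) \<Rightarrow> 'f" where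
  "monomial x m = (\<Prod>i\<in>UNIV. x i ^ Poly_Mapping.lookup m i)"

lemma monomial_add: "monomial x (m + m') = monomial x m * monomial x m'"
  by (simp add: monomial_def lookup_add power_add prod.distrib)

lemma monomial_zero [simp]: "monomial x 0 = 1"
  by (simp add: monomial_def)

lemma monomial_single: "monomial x (Poly_Mapping.single k d) = x k ^ d"
proof -
  have "monomial x (Poly_Mapping.single k d) = (\<Prod>i\<in>UNIV. if i = k then x k ^ d else 1)"
    unfolding monomial_def by (intro prod.cong) (auto simp: lookup_single when_def)
  then show ?thesis by simp
qed

lemma poly_mapping_sum_single:
  "(\<Sum>m\<in>Poly_Mapping.keys f. Poly_Mapping.single m (Poly_Mapping.lookup f m)) = f"
  by (rule poly_mapping_eqI)
     (auto simp: lookup_sum lookup_single when_def in_keys_iff sum.delta)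

lemma poly_eval_superset:
  assumes "finite K" "Poly_Mapping.keys f \<subseteq> K"
  shows "poly_eval f x = (\<Sum>m\<in>K. Poly_Mapping.lookup f m * monomial x m)"
  unfolding poly_eval_def monomial_def using assms
  by (intro sum.mono_neutral_left) (auto simp: in_keys_iff)

lemma poly_eval_zero [simp]: "poly_eval 0 x = 0"
  by (simp add: poly_eval_def)

lemma poly_eval_add: "poly_eval (f + g) x = poly_eval f x + poly_eval g x"
proof -
  let ?K = "Poly_Mapping.keys f \<union> Poly_Mapping.keys g"
  have "poly_eval (f + g) x = (\<Sum>m\<in>?K. Poly_Mapping.lookup (f + g) m * monomial x m)"
    using keys_add[of f g] by (intro poly_eval_superset) auto
  also have "\<dots> = poly_eval f x + poly_eval g x"
    by (simp add: poly_eval_superset[of ?K] lookup_add distrib_right sum.distrib)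
  finally show ?thesis .
qed

lemma poly_eval_diff: "poly_eval (f - g) x = poly_eval f x - poly_eval g x"
  using poly_eval_add[of "f - g" g x] by simp

lemma poly_eval_sum: "poly_eval (sum f A) x = (\<Sum>a\<in>A. poly_eval (f a) x)"
  by (induction A rule: infinite_finite_induct) (auto simp: poly_eval_add)

lemma poly_eval_single: "poly_eval (Poly_Mapping.single m a) x = a * monomial x m"
  using poly_eval_superset[of "{m}" "Poly_Mapping.single m a" x] by simp

text \<open>Reduces claims about a product, such as its evaluation or its support, to claims about
  single terms.\<close>

lemma poly_mapping_mult_eq_sum:
  "f * g = (\<Sum>m\<in>Poly_Mapping.keys f. \<Sum>m'\<in>Poly_Mapping.keys g.
     Poly_Mapping.single (m + m') (Poly_Mapping.lookup f m * Poly_Mapping.lookup g m'))"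
proof -
  have "f * g = (\<Sum>m\<in>Poly_Mapping.keys f. Poly_Mapping.single m (Poly_Mapping.lookup f m)) *
      (\<Sum>m\<in>Poly_Mapping.keys g. Poly_Mapping.single m (Poly_Mapping.lookup g m))"
    by (simp only: poly_mapping_sum_single)
  then show ?thesis by (simp add: sum_product mult_single)
qed

lemma poly_eval_mult: "poly_eval (f * g) x = poly_eval f x * poly_eval g x"
proof -
  have "poly_eval (f * g) x = (\<Sum>m\<in>Poly_Mapping.keys f. \<Sum>m'\<in>Poly_Mapping.keys g.
     (Poly_Mapping.lookup f m * monomial x m) * (Poly_Mapping.lookup g m' * monomial x m'))"
    by (subst poly_mapping_mult_eq_sum)
       (simp add: poly_eval_sum poly_eval_single monomial_add mult_ac)
  then show ?thesis
    by (simp add: sum_product poly_eval_def monomial_def)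
qed

lemma poly_eval_one [simp]: "poly_eval 1 x = 1"
  using poly_eval_single[of 0 1 x] by simp

lemma poly_eval_power: "poly_eval (f ^ d) x = poly_eval f x ^ d"
  by (induction d) (auto simp: poly_eval_mult)

section \<open>Polynomials over a subring that avoid one variable\<close>

definition subring :: "'a::comm_ring_1 set \<Rightarrow> bool" where
  "subring R \<longleftrightarrow> 0 \<in> R \<and> 1 \<in> R \<and> (\<forall>a\<in>R. \<forall>b\<in>R. a + b \<in> R \<and> a - b \<in> R \<and> a * b \<in> R)"

lemma subring_mult: "subring R \<Longrightarrow> a \<in> R \<Longrightarrow> b \<in> R \<Longrightarrow> a * b \<in> R"
  by (auto simp: subring_def)

lemma subring_sum: "subring R \<Longrightarrow> (\<And>a. a \<in> A \<Longrightarrow> f a \<in> R) \<Longrightarrow> sum f A \<in> R"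
  by (induction A rule: infinite_finite_induct) (auto simp: subring_def)

lemma subring_power: "subring R \<Longrightarrow> a \<in> R \<Longrightarrow> a ^ n \<in> R"
  by (induction n) (auto simp: subring_def)

text \<open>The polynomial ring over \<open>R\<close> in the variables other than \<open>k\<close>,
  kept inside the polynomials in all variables so that no type with one variable fewer is
  needed.\<close>

definition polys_without :: "'n \<Rightarrow> 'f::comm_ring_1 set \<Rightarrow> (('n \<Rightarrow>\<^sub>0 nat) \<Rightarrow>\<^sub>0 'f) set" where
  "polys_without k R = {f. range (Poly_Mapping.lookup f) \<subseteq> R \<and>
     (\<forall>m\<in>Poly_Mapping.keys f. Poly_Mapping.lookup m k = 0)}"

lemma polys_without_lookup: "f \<in> polys_without k R \<Longrightarrow> Poly_Mapping.lookup f m \<in> R"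
  by (auto simp: polys_without_def)

lemma polys_without_zero: "subring R \<Longrightarrow> 0 \<in> polys_without k R"
  by (auto simp: polys_without_def subring_def)

lemma polys_without_single:
  assumes "subring R" "a \<in> R" "Poly_Mapping.lookup m k = 0"
  shows "Poly_Mapping.single m a \<in> polys_without k R"
  using assms by (auto simp: polys_without_def subring_def lookup_single when_def split: if_splits)

lemma polys_without_add:
  assumes "subring R" "f \<in> polys_without k R" "g \<in> polys_without k R"
  shows "f + g \<in> polys_without k R"
  using assms keys_add[of f g] by (auto simp: polys_without_def subring_def lookup_add image_subset_iff)

lemma polys_without_sum:
  assumes "subring R" "\<And>a. a \<in> A \<Longrightarrow> f a \<in> polys_without k R"
  shows "sum f A \<in> polys_without k R"
  using assms(2)
  by (induction A rule: infinite_finite_induct)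
     (auto simp: polys_without_add[OF assms(1)] polys_without_zero[OF assms(1)])

lemma polys_without_mult:
  assumes R: "subring R" and f: "f \<in> polys_without k R" and g: "g \<in> polys_without k R"
  shows "f * g \<in> polys_without k R"
proof (subst poly_mapping_mult_eq_sum, intro polys_without_sum[OF R] polys_without_single[OF R])
  fix m m' assume m: "m \<in> Poly_Mapping.keys f" "m' \<in> Poly_Mapping.keys g"
  show "Poly_Mapping.lookup f m * Poly_Mapping.lookup g m' \<in> R"
    using R f g by (intro subring_mult polys_without_lookup)
  show "Poly_Mapping.lookup (m + m') k = 0"
    using m f g by (auto simp: polys_without_def lookup_add)
qed

lemma polys_without_power:
  "subring R \<Longrightarrow> f \<in> polys_without k R \<Longrightarrow> f ^ d \<in> polys_without k R"
  by (induction d)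
     (auto intro: polys_without_mult polys_without_single[of R 1 0 k, simplified] simp: subring_def)

lemma poly_eval_polys_without_cong:
  assumes "f \<in> polys_without k R" "\<And>j. j \<noteq> k \<Longrightarrow> x j = y j"
  shows "poly_eval f x = poly_eval f y"
  unfolding poly_eval_def
proof (intro sum.cong refl arg_cong2[of _ _ _ _ times] prod.cong)
  fix m i assume "m \<in> Poly_Mapping.keys f"
  then show "x i ^ Poly_Mapping.lookup m i = y i ^ Poly_Mapping.lookup m i"
    using assms by (cases "i = k") (auto simp: polys_without_def)
qed

lemma poly_mapping_update_zero_add_single:
  "Poly_Mapping.update k 0 m + Poly_Mapping.single k (Poly_Mapping.lookup m k) = (m :: 'n \<Rightarrow>\<^sub>0 nat)"
  by (rule poly_mapping_eqI) (auto simp: lookup_add lookup_update lookup_single when_def)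

text \<open>All exponent vectors of the product have degree \<open>e\<close> in \<open>k\<close>, so
  one of degree \<open>d\<close> can occur only if \<open>d = e\<close>. This recovers the
  coefficient polynomials of a polynomial in \<open>x k\<close>.\<close>

lemma lookup_mult_single:
  fixes g :: "('n \<Rightarrow>\<^sub>0 nat) \<Rightarrow>\<^sub>0 'f::comm_ring_1"
  assumes "\<forall>m\<in>Poly_Mapping.keys g. Poly_Mapping.lookup m k = 0" "Poly_Mapping.lookup m k = 0"
  shows "Poly_Mapping.lookup (g * Poly_Mapping.single (Poly_Mapping.single k e) 1)
      (m + Poly_Mapping.single k d) = (if d = e then Poly_Mapping.lookup g m else 0)"
proof -
  have eq: "m' + Poly_Mapping.single k e = m + Poly_Mapping.single k d \<longleftrightarrow> m' = m \<and> d = e"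
    if "m' \<in> Poly_Mapping.keys g" for m'
  proof
    assume *: "m' + Poly_Mapping.single k e = m + Poly_Mapping.single k d"
    from * have "Poly_Mapping.lookup (m' + Poly_Mapping.single k e) k =
        Poly_Mapping.lookup (m + Poly_Mapping.single k d) k" by simp
    with assms that have "d = e" by (simp add: lookup_add)
    with * show "m' = m \<and> d = e" by simp
  qed auto
  have "g * Poly_Mapping.single (Poly_Mapping.single k e) 1 =
      (\<Sum>m'\<in>Poly_Mapping.keys g. Poly_Mapping.single m' (Poly_Mapping.lookup g m')) *
      Poly_Mapping.single (Poly_Mapping.single k e) 1"
    by (simp only: poly_mapping_sum_single)
  then have "Poly_Mapping.lookup (g * Poly_Mapping.single (Poly_Mapping.single k e) 1)
      (m + Poly_Mapping.single k d) =
      (\<Sum>m'\<in>Poly_Mapping.keys g. if m' = m \<and> d = e then Poly_Mapping.lookup g m' else 0)"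
    by (auto simp: sum_distrib_right mult_single lookup_sum lookup_single when_def eq intro!: sum.cong)
  then show ?thesis
    by (cases "d = e") (auto simp: sum.delta in_keys_iff)
qed

lemma algebraically_independentD:
  assumes "algebraically_independent R x" "range (Poly_Mapping.lookup f) \<subseteq> R" "poly_eval f x = 0"
  shows "f = 0"
  using assms by (auto simp: algebraically_independent_def)

text \<open>
  Equivalently, \<open>x k\<close> is transcendental over the algebra generated by the remaining variables,
  and those are independent.
\<close>

lemma algebraically_independent_iff_powers:
  assumes R: "subring R"
  shows "algebraically_independent R x \<longleftrightarrow>
    (\<forall>D g. (\<forall>d\<le>D. g d \<in> polys_without k R) \<and> (\<Sum>d\<le>D. poly_eval (g d) x * x k ^ d) = 0 \<longrightarrow>
       (\<forall>d\<le>D::nat. g d = 0))"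
proof (intro iffI allI impI; (elim conjE)?)
  fix D g d
  assume x: "algebraically_independent R x"
    and g: "\<forall>d\<le>D. g d \<in> polys_without k R"
    and sum0: "(\<Sum>d\<le>D. poly_eval (g d) x * x k ^ d) = 0" and d: "d \<le> D"
  \<comment> \<open>Reassemble the polynomial in \<open>x k\<close> into one polynomial in all
    variables. It has coefficients in \<open>R\<close> and vanishes at \<open>x\<close>.\<close>
  define f where "f = (\<Sum>d\<le>D. g d * Poly_Mapping.single (Poly_Mapping.single k d) 1)"
  have R_mult: "range (Poly_Mapping.lookup (g d * Poly_Mapping.single (Poly_Mapping.single k d) 1)) \<subseteq> R"
    if "d \<le> D" for d
    using R g that
    by (subst poly_mapping_mult_eq_sum)
       (auto simp: lookup_sum lookup_single when_def subring_def[of R] polys_without_lookup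
          intro!: subring_sum)
  have "range (Poly_Mapping.lookup f) \<subseteq> R"
    using R_mult by (auto simp: f_def lookup_sum intro!: subring_sum R)
  moreover have "poly_eval f x = 0"
    using sum0 by (simp add: f_def poly_eval_sum poly_eval_mult poly_eval_single monomial_single)
  ultimately have f: "f = 0" by (rule algebraically_independentD[OF x])
  show "g d = 0"
  proof (rule poly_mapping_eqI)
    fix m
    show "Poly_Mapping.lookup (g d) m = Poly_Mapping.lookup 0 m"
    proof (cases "Poly_Mapping.lookup m k = 0")
      case True
      have "0 = Poly_Mapping.lookup f (m + Poly_Mapping.single k d)" using f by simp
      also have "\<dots> = (\<Sum>e\<le>D. if d = e then Poly_Mapping.lookup (g e) m else 0)"
        unfolding f_def lookup_sum using g True
        by (intro sum.cong refl lookup_mult_single) (auto simp: polys_without_def)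
      finally show ?thesis using d by simp
    next
      case False
      then have "m \<notin> Poly_Mapping.keys (g d)" using g d by (auto simp: polys_without_def)
      then show ?thesis by (simp add: in_keys_iff)
    qed
  qed
next
  assume *: "\<forall>D g. (\<forall>d\<le>D. g d \<in> polys_without k R) \<and>
    (\<Sum>d\<le>D. poly_eval (g d) x * x k ^ d) = 0 \<longrightarrow> (\<forall>d\<le>D::nat. g d = 0)"
  show "algebraically_independent R x"
    unfolding algebraically_independent_def
  proof (intro allI impI, elim conjE)
    fix f assume fR: "range (Poly_Mapping.lookup f) \<subseteq> R" and f0: "poly_eval f x = 0"
    let ?K = "Poly_Mapping.keys f" and ?deg = "\<lambda>m. Poly_Mapping.lookup m k"
    let ?h = "\<lambda>m. Poly_Mapping.single (Poly_Mapping.update k 0 m) (Poly_Mapping.lookup f m)"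
    \<comment> \<open>Conversely, sort the terms of \<open>f\<close> by their degree in
      \<open>x k\<close> and strip off that power. The inserted \<open>0\<close> keeps
      \<open>Max\<close> meaningful when \<open>f\<close> has no terms.\<close>
    define D where "D = Max (insert 0 (?deg ` ?K))"
    define g where "g d = (\<Sum>m\<in>{m\<in>?K. ?deg m = d}. ?h m)" for d
    have D: "?deg m \<le> D" if "m \<in> ?K" for m
      using that unfolding D_def by (intro Max_ge) auto
    have "g d \<in> polys_without k R" for d
      unfolding g_def using fR
      by (intro polys_without_sum polys_without_single R) (auto simp: lookup_update)
    moreover have "(\<Sum>d\<le>D. poly_eval (g d) x * x k ^ d) = 0"
    proof -
      have "(\<Sum>d\<le>D. poly_eval (g d) x * x k ^ d) =
          (\<Sum>d\<le>D. \<Sum>m\<in>{m\<in>?K. ?deg m = d}. Poly_Mapping.lookup f m * monomial x m)"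
        unfolding g_def poly_eval_sum sum_distrib_right
      proof (intro sum.cong refl)
        fix d m assume "m \<in> {m\<in>?K. ?deg m = d}"
        then have "m = Poly_Mapping.update k 0 m + Poly_Mapping.single k d"
          using poly_mapping_update_zero_add_single[of k m] by simp
        then have "monomial x m = monomial x (Poly_Mapping.update k 0 m) * x k ^ d"
          by (metis monomial_add monomial_single)
        then show "poly_eval (?h m) x * x k ^ d = Poly_Mapping.lookup f m * monomial x m"
          by (simp add: poly_eval_single)
      qed
      also have "\<dots> = (\<Sum>m\<in>?K. Poly_Mapping.lookup f m * monomial x m)"
        using D by (intro sum.group) auto
      finally show ?thesis using f0 by (simp add: poly_eval_def monomial_def)
    qed
    ultimately have g0: "g d = 0" if "d \<le> D" for d using * that by blast
    show "f = 0"
    proof (rule ccontr)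
      assume "f \<noteq> 0"
      then obtain m where m: "m \<in> ?K" by (metis ex_in_conv keys_eq_empty)
      have "0 = Poly_Mapping.lookup (g (?deg m)) (Poly_Mapping.update k 0 m)"
        using g0[OF D[OF m]] by simp
      \<comment> \<open>Among terms of the same degree in \<open>x k\<close>, stripping off the
        power of \<open>x k\<close> is injective, so no other term interferes with the coefficient
        of \<open>m\<close>.\<close>
      also have "\<dots> = (\<Sum>m'\<in>{m'\<in>?K. ?deg m' = ?deg m}. if m' = m then Poly_Mapping.lookup f m' else 0)"
        unfolding g_def lookup_sum
      proof (intro sum.cong refl)
        fix m' assume "m' \<in> {m'\<in>?K. ?deg m' = ?deg m}"
        then have "Poly_Mapping.update k 0 m' = Poly_Mapping.update k 0 m \<longleftrightarrow> m' = m"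
          by (metis (mono_tags, lifting) mem_Collect_eq poly_mapping_update_zero_add_single)
        then show "Poly_Mapping.lookup (?h m') (Poly_Mapping.update k 0 m) =
            (if m' = m then Poly_Mapping.lookup f m' else 0)"
          by (auto simp: lookup_single when_def)
      qed
      also have "\<dots> = Poly_Mapping.lookup f m"
        using m by (simp add: sum.delta)
      finally show False using m by (simp add: in_keys_iff)
    qed
  qed
qed

text \<open>
  Clearing the denominators of a relation among the mutated variables gives a relation among the
  old ones, in which the coefficient of each power of \<open>x k\<close> is multiplied by a power of the
  exchange polynomial \<open>M\<close>.
\<close>

lemma algebraically_independent_exchange:
  assumes R: "subring R" and x: "algebraically_independent R x"
    and M: "M \<in> polys_without k R" "poly_eval M x \<noteq> 0"
    and x': "\<And>j. j \<noteq> k \<Longrightarrow> x' j = x j" and k: "x k * x' k = poly_eval M x"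
  shows "algebraically_independent R x'"
  unfolding algebraically_independent_iff_powers[OF R, where k = k and x = x']
proof (intro allI impI, elim conjE)
  fix D g d
  assume g: "\<forall>d\<le>D. g d \<in> polys_without k R"
    and sum0: "(\<Sum>d\<le>D. poly_eval (g d) x' * x' k ^ d) = 0" and d: "d \<le> D"
  \<comment> \<open>Since \<open>x' k\<close> is the value of \<open>M\<close> divided by
    \<open>x k\<close>, multiplying the relation by \<open>x k ^ D\<close> reverses the order of the
    powers: degree \<open>d\<close> becomes degree \<open>D - d\<close>, with the extra factor
    \<open>M ^ d\<close>.\<close>
  define h where "h e = g (D - e) * M ^ (D - e)" for e
  have h: "\<forall>e\<le>D. h e \<in> polys_without k R"
    using g M R by (auto simp: h_def intro!: polys_without_mult polys_without_power)
  have "(\<Sum>e\<le>D. poly_eval (h e) x * x k ^ e) = (\<Sum>d\<le>D. poly_eval (h (D - d)) x * x k ^ (D - d))"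
    by (rule sum.reindex_bij_witness[of _ "\<lambda>d. D - d" "\<lambda>d. D - d"]) auto
  also have "\<dots> = (\<Sum>d\<le>D. poly_eval (g d) x' * x' k ^ d * x k ^ D)"
  proof (intro sum.cong refl)
    fix d assume "d \<in> {..D}"
    then have "x k ^ D = x k ^ d * x k ^ (D - d)" by (simp flip: power_add)
    moreover have "poly_eval (g d) x' = poly_eval (g d) x"
      using g x' \<open>d \<in> {..D}\<close> by (intro poly_eval_polys_without_cong[of _ k R]) auto
    ultimately show "poly_eval (h (D - d)) x * x k ^ (D - d) = poly_eval (g d) x' * x' k ^ d * x k ^ D"
      using \<open>d \<in> {..D}\<close> by (simp add: h_def poly_eval_mult poly_eval_power power_mult_distrib flip: k)
  qed
  also have "\<dots> = 0" using sum0 by (simp flip: sum_distrib_right)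
  finally have "\<forall>e\<le>D. h e = 0"
    using x h unfolding algebraically_independent_iff_powers[OF R, where k = k and x = x] by blast
  then have "poly_eval (g d * M ^ d) x = 0"
    using d by (auto simp: h_def dest!: spec[of _ "D - d"])
  then have "poly_eval (g d) x = 0" using M by (simp add: poly_eval_mult poly_eval_power)
  then show "g d = 0"
    using g d by (intro algebraically_independentD[OF x]) (auto simp: polys_without_def)
qed

text \<open>The scalars can be moved into the coefficients: each coefficient gets multiplied by a
  monomial in the \<open>c i\<close>, which is a nonzero element of \<open>R\<close>, so a nonzero
  relation stays nonzero.\<close>

lemma algebraically_independent_rescale:
  assumes R: "subring R" and x: "algebraically_independent R x"
    and c: "\<And>i. c i \<in> R" "\<And>i. c i \<noteq> 0"
  shows "algebraically_independent R (\<lambda>i. c i * x i)"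
  unfolding algebraically_independent_def
proof (intro allI impI, elim conjE)
  fix f assume fR: "range (Poly_Mapping.lookup f) \<subseteq> R" and f0: "poly_eval f (\<lambda>i. c i * x i) = 0"
  define g where "g = Poly_Mapping.mapp (\<lambda>m a. a * monomial c m) f"
  have cR: "monomial c m \<in> R" for m
  proof -
    have "prod (\<lambda>i. c i ^ Poly_Mapping.lookup m i) A \<in> R" for A
      by (induction A rule: infinite_finite_induct)
         (use R c in \<open>auto simp: subring_def[of R] intro!: subring_mult subring_power\<close>)
    then show ?thesis by (simp add: monomial_def)
  qed
  have lookup_g: "Poly_Mapping.lookup g m = Poly_Mapping.lookup f m * monomial c m" for m
    by (auto simp: g_def lookup_mapp when_def in_keys_iff)
  have "range (Poly_Mapping.lookup g) \<subseteq> R"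
    using fR cR R by (auto simp: lookup_g subring_def)
  moreover have "poly_eval g x = (\<Sum>m\<in>Poly_Mapping.keys f. Poly_Mapping.lookup g m * monomial x m)"
    by (rule poly_eval_superset) (simp_all add: g_def keys_mapp_subset)
  then have "poly_eval g x = 0"
    using f0 by (simp add: lookup_g poly_eval_def monomial_def power_mult_distrib prod.distrib mult.assoc)
  ultimately have "g = 0" by (rule algebraically_independentD[OF x])
  then have "Poly_Mapping.lookup f m * monomial c m = 0" for m by (simp flip: lookup_g)
  moreover have "monomial c m \<noteq> 0" for m using c by (simp add: monomial_def)
  ultimately show "f = 0" by (intro poly_mapping_eqI) simp
qed

section \<open>Semifields and specialization\<close>

lemma mult_group_1: "mult_group S \<Longrightarrow> 1 \<in> S"
  and mult_group_nonzero: "mult_group S \<Longrightarrow> a \<in> S \<Longrightarrow> a \<noteq> 0"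
  and mult_group_mult: "mult_group S \<Longrightarrow> a \<in> S \<Longrightarrow> b \<in> S \<Longrightarrow> a * b \<in> S"
  and mult_group_inverse: "mult_group S \<Longrightarrow> a \<in> S \<Longrightarrow> inverse a \<in> S"
  by (auto simp: mult_group_def)

lemma mult_group_divide: "mult_group S \<Longrightarrow> a \<in> S \<Longrightarrow> b \<in> S \<Longrightarrow> a / b \<in> S"
  by (simp add: divide_inverse mult_group_inverse mult_group_mult)

lemma mult_group_power_int: "mult_group S \<Longrightarrow> a \<in> S \<Longrightarrow> a powi n \<in> S"
proof -
  assume *: "mult_group S" "a \<in> S"
  have "a ^ k \<in> S" "inverse a ^ k \<in> S" for k
    using * by (induction k) (auto simp: mult_group_def)
  then show "a powi n \<in> S" by (simp add: power_int_def)
qed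

lemma mult_group_prod: "mult_group S \<Longrightarrow> (\<And>i. i \<in> A \<Longrightarrow> f i \<in> S) \<Longrightarrow> prod f A \<in> S"
  by (induction A rule: infinite_finite_induct) (auto simp: mult_group_def)

lemma coefficient_group_mult_group: "coefficient_group P \<Longrightarrow> mult_group P"
  by (simp add: coefficient_group_def)

interpretation rat_vec: vector_space "rat_scale :: rat \<Rightarrow> 'f::field_char_0 \<Rightarrow> 'f"
  by unfold_locales (auto simp: algebra_simps of_rat_add of_rat_mult)

text \<open>Products are handled by linearity in one factor at a time; closure of \<open>P\<close>
  under multiplication enters only for a group element times a combination.\<close>

lemma subring_group_ring:
  assumes "mult_group P"
  shows "subring (group_ring P)"
proof -
  have mult1: "p * b \<in> group_ring P" if "b \<in> group_ring P" "p \<in> P" for p b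
    using that(1)
  proof (induction rule: rat_vec.span_induct_alt)
    case base show ?case by (simp add: rat_vec.span_zero)
  next
    case (step r q y)
    then have "rat_scale r (p * q) + p * y \<in> group_ring P"
      using that assms by (blast intro: rat_vec.span_add rat_vec.span_scale rat_vec.span_base mult_group_mult)
    then show ?case by (simp add: algebra_simps)
  qed
  have "a * b \<in> group_ring P" if "a \<in> group_ring P" "b \<in> group_ring P" for a b
    using that(1)
  proof (induction rule: rat_vec.span_induct_alt)
    case base show ?case by (simp add: rat_vec.span_zero)
  next
    case (step r q y)
    then have "rat_scale r (q * b) + y * b \<in> group_ring P"
      using that mult1 by (blast intro: rat_vec.span_add rat_vec.span_scale)
    then show ?case by (simp add: algebra_simps)
  qed
  then show ?thesis
    using mult_group_1[OF assms]
    by (auto simp: subring_def intro: rat_vec.span_zero rat_vec.span_base rat_vec.span_add rat_vec.span_diff)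
qed

section \<open>Uniqueness of the terms of a positive sum\<close>

lemma independent_sum_mset_inject:
  assumes "\<not> module.dependent rat_scale P" "set_mset A \<subseteq> P" "set_mset B \<subseteq> P"
    and "sum_mset A = sum_mset B"
  shows "A = B"
proof -
  let ?T = "set_mset A \<union> set_mset B"
  have sum_eq: "sum_mset M = (\<Sum>v\<in>?T. of_nat (count M v) * v)" if "set_mset M \<subseteq> ?T" for M
    using that
  proof (induction M)
    case (add a M)
    have "(\<Sum>v\<in>?T. of_nat (count (add_mset a M) v) * v) =
        (\<Sum>v\<in>?T. (if v = a then v else 0) + of_nat (count M v) * v)"
      by (intro sum.cong) (auto simp: algebra_simps)
    also have "\<dots> = a + (\<Sum>v\<in>?T. of_nat (count M v) * v)"
      using add.prems by (simp add: sum.distrib)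
    finally show ?case using add by simp
  qed simp
  \<comment> \<open>The differences of multiplicities are the coefficients of a vanishing rational
    combination of elements of \<open>P\<close>.\<close>
  have "(\<Sum>v\<in>?T. rat_scale (of_nat (count A v) - of_nat (count B v)) v) =
      (\<Sum>v\<in>?T. of_nat (count A v) * v - of_nat (count B v) * v)"
    by (intro sum.cong) (auto simp: of_rat_diff algebra_simps)
  also have "\<dots> = 0" using assms(4) sum_eq[of A] sum_eq[of B] by (simp add: sum_subtractf)
  finally have "of_nat (count A v) - of_nat (count B v) = (0 :: rat)" if "v \<in> ?T" for v
    using rat_vec.independentD[OF assms(1), of ?T "\<lambda>v. of_nat (count A v) - of_nat (count B v)"]
      assms(2,3) that by simp
  then have "count A v = count B v" for v
    by (cases "v \<in> ?T") (auto simp: not_in_iff)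
  then show ?thesis by (rule multiset_eqI)
qed

text \<open>Two kinds of independence combine: that of \<open>x\<close> over the group ring
  separates the exponent vectors, and that of \<open>P\<close> over the rationals separates the
  coefficients attached to one exponent vector, including their multiplicities.\<close>

lemma term_multiset_inject:
  fixes A B :: "('f::field_char_0 \<times> ('n::finite \<Rightarrow>\<^sub>0 nat)) multiset"
  assumes P: "\<not> module.dependent rat_scale P" "mult_group P"
    and x: "algebraically_independent (group_ring P) x"
    and A: "fst ` set_mset A \<subseteq> P" and B: "fst ` set_mset B \<subseteq> P"
    and eq: "(\<Sum>(p, m)\<in>#A. p * monomial x m) = (\<Sum>(p, m)\<in>#B. p * monomial x m)"
  shows "A = B"
proof -
  define F where "F M = (\<Sum>(p, m)\<in>#M. Poly_Mapping.single m p)"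
    for M :: "('f \<times> ('n \<Rightarrow>\<^sub>0 nat)) multiset"
  define G where "G M m = image_mset fst (filter_mset (\<lambda>q. snd q = m) M)"
    for M :: "('f \<times> ('n \<Rightarrow>\<^sub>0 nat)) multiset" and m
  have R: "subring (group_ring P)" using P(2) by (rule subring_group_ring)
  have eval_F: "poly_eval (F M) x = (\<Sum>(p, m)\<in>#M. p * monomial x m)" for M
    by (induction M) (auto simp: F_def poly_eval_add poly_eval_single)
  have lookup_F: "Poly_Mapping.lookup (F M) m = sum_mset (G M m)" for M m
    by (induction M) (auto simp: F_def G_def lookup_add lookup_single when_def)
  have count_G: "count (G M m) p = count M (p, m)" for M m p
    by (induction M) (auto simp: G_def)
  have F_R: "Poly_Mapping.lookup (F M) m \<in> group_ring P" if "fst ` set_mset M \<subseteq> P" for M m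
    using that
  proof (induction M)
    case empty
    then show ?case by (simp add: F_def rat_vec.span_zero)
  next
    case (add q M)
    then have "Poly_Mapping.lookup (Poly_Mapping.single (snd q) (fst q)) m \<in> group_ring P"
      by (auto simp: lookup_single when_def intro: rat_vec.span_zero rat_vec.span_base)
    then show ?case
      using add by (auto simp: F_def lookup_add split: prod.splits intro: rat_vec.span_add)
  qed
  have "F A - F B = 0"
  proof (rule algebraically_independentD[OF x])
    show "range (Poly_Mapping.lookup (F A - F B)) \<subseteq> group_ring P"
      using F_R[OF A] F_R[OF B] by (auto simp: lookup_minus intro: rat_vec.span_diff)
    show "poly_eval (F A - F B) x = 0" using eq by (simp add: poly_eval_diff eval_F)
  qed
  then have "sum_mset (G A m) = sum_mset (G B m)" for m by (simp flip: lookup_F)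
  then have "G A m = G B m" for m
    using A B by (intro independent_sum_mset_inject[OF P(1)]) (auto simp: G_def)
  then show ?thesis by (intro multiset_eqI) (metis count_G surj_pair)
qed

text \<open>
  Sums over multisets in a semifield \<open>P\<close>, which has no zero: \<open>None\<close> is the empty sum. Outside of
  \<open>P\<close>, where nothing is known about \<open>add\<close>, the value \<open>0\<close> makes the fold commutative.
\<close>

definition semifield_fold :: "'f::field set \<Rightarrow> ('f \<Rightarrow> 'f \<Rightarrow> 'f) \<Rightarrow> 'f multiset \<Rightarrow> 'f option" where
  "semifield_fold P add = fold_mset (\<lambda>p acc. Some (case acc of None \<Rightarrow> p
     | Some a \<Rightarrow> if p \<in> P \<and> a \<in> P then add p a else 0)) None"

definition semifield_sum :: "'f::field set \<Rightarrow> ('f \<Rightarrow> 'f \<Rightarrow> 'f) \<Rightarrow> 'f multiset \<Rightarrow> 'f" where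
  "semifield_sum P add A = the (semifield_fold P add A)"

lemma semifieldD:
  assumes "semifield P add"
  shows "mult_group P"
    and "a \<in> P \<Longrightarrow> b \<in> P \<Longrightarrow> add a b \<in> P"
    and "a \<in> P \<Longrightarrow> b \<in> P \<Longrightarrow> add a b = add b a"
    and "a \<in> P \<Longrightarrow> b \<in> P \<Longrightarrow> c \<in> P \<Longrightarrow> add (add a b) c = add a (add b c)"
    and "a \<in> P \<Longrightarrow> b \<in> P \<Longrightarrow> c \<in> P \<Longrightarrow> a * add b c = add (a * b) (a * c)"
  using assms unfolding semifield_def by blast+

lemma semifield_fold_add_mset:
  assumes P: "semifield P add"
  shows "semifield_fold P add (add_mset p A) = Some (case semifield_fold P add A of None \<Rightarrow> p
     | Some a \<Rightarrow> if p \<in> P \<and> a \<in> P then add p a else 0)"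
proof -
  have left_comm: "add p (add q a) = add q (add p a)" if "p \<in> P" "q \<in> P" "a \<in> P" for p q a
    using that semifieldD(3,4)[OF P] by metis
  \<comment> \<open>A sum of two or more summands, one of them outside of \<open>P\<close>, is
    \<open>0\<close> in either order, because \<open>0\<close> is itself outside of
    \<open>P\<close>.\<close>
  have "0 \<notin> P" using semifieldD(1)[OF P] by (simp add: mult_group_def)
  then interpret comp_fun_commute "\<lambda>p acc. Some (case acc of None \<Rightarrow> p
     | Some a \<Rightarrow> if p \<in> P \<and> a \<in> P then add p a else 0)"
    using semifieldD(2,3)[OF P] left_comm
    by unfold_locales (auto simp: fun_eq_iff split: option.splits)
  show ?thesis by (simp add: semifield_fold_def)
qed

lemma semifield_fold_empty [simp]: "semifield_fold P add {#} = None"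
  by (simp add: semifield_fold_def)

lemma semifield_fold_eq_None_iff:
  "semifield P add \<Longrightarrow> semifield_fold P add A = None \<longleftrightarrow> A = {#}"
  by (cases A) (simp_all add: semifield_fold_add_mset)

lemma semifield_sum_single: "semifield P add \<Longrightarrow> semifield_sum P add {#p#} = p"
  by (simp add: semifield_sum_def semifield_fold_add_mset)

lemma semifield_sum_in:
  assumes P: "semifield P add" and "set_mset A \<subseteq> P" "A \<noteq> {#}"
  shows "semifield_sum P add A \<in> P"
  using assms(2,3)
proof (induction A)
  case (add p A)
  then show ?case
    using semifieldD(2)[OF P]
    by (cases "A = {#}"; cases "semifield_fold P add A")
       (auto simp: semifield_sum_def semifield_fold_add_mset[OF P] semifield_fold_eq_None_iff[OF P])
qed simp

lemma semifield_sum_add_mset: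
  assumes P: "semifield P add" and "p \<in> P" "set_mset A \<subseteq> P" "A \<noteq> {#}"
  shows "semifield_sum P add (add_mset p A) = add p (semifield_sum P add A)"
  using semifield_sum_in[OF P assms(3,4)] assms
  by (cases "semifield_fold P add A")
     (auto simp: semifield_sum_def semifield_fold_add_mset[OF P] semifield_fold_eq_None_iff[OF P])

lemma semifield_sum_union:
  assumes P: "semifield P add" and A: "set_mset A \<subseteq> P" "A \<noteq> {#}" and B: "set_mset B \<subseteq> P" "B \<noteq> {#}"
  shows "semifield_sum P add (A + B) = add (semifield_sum P add A) (semifield_sum P add B)"
  using A
proof (induction A)
  case (add p A)
  show ?case
  proof (cases "A = {#}")
    case True
    then show ?thesis
      using add.prems B by (simp add: semifield_sum_add_mset[OF P] semifield_sum_single[OF P])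
  next
    case False
    then show ?thesis
      using add B semifieldD(4)[OF P] semifield_sum_in[OF P]
      by (simp add: semifield_sum_add_mset[OF P])
  qed
qed simp

text \<open>
  The graph, on polynomials, of the specialization of all variables to \<open>1\<close>. It is single-valued
  because the terms \<open>p * monomial x m\<close> are linearly independent over the rational numbers.
\<close>

inductive positive_value ::
  "'f::field set \<Rightarrow> ('f \<Rightarrow> 'g) \<Rightarrow> ('g \<Rightarrow> 'g \<Rightarrow> 'g) \<Rightarrow> ('n::finite \<Rightarrow> 'f) \<Rightarrow> 'f \<Rightarrow> 'g \<Rightarrow> bool"
  for P h add x where
  single: "p \<in> P \<Longrightarrow> positive_value P h add x (p * monomial x m) (h p)"
| add: "positive_value P h add x a u \<Longrightarrow> positive_value P h add x b v \<Longrightarrow>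
    positive_value P h add x (a + b) (add u v)"

text \<open>Allowing a multiplicative map \<open>h\<close> into another semifield serves two ends:
  the identity yields the specialization, and the constant map to \<open>{1}\<close> excludes
  \<open>0\<close> from the subtraction-free expressions.\<close>

locale coefficient_hom =
  fixes P :: "'f::field_char_0 set" and Q :: "'g::field set" and add :: "'g \<Rightarrow> 'g \<Rightarrow> 'g"
    and h :: "'f \<Rightarrow> 'g" and x :: "'n::finite \<Rightarrow> 'f"
  assumes P: "coefficient_group P" and Q: "semifield Q add" and x: "freely_generates P x"
    and h_in: "\<And>p. p \<in> P \<Longrightarrow> h p \<in> Q"
    and h_mult: "\<And>p q. p \<in> P \<Longrightarrow> q \<in> P \<Longrightarrow> h (p * q) = h p * h q"
begin

abbreviation val :: "'f \<Rightarrow> 'g \<Rightarrow> bool" where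
  "val \<equiv> positive_value P h add x"

lemma mult_group: "mult_group P" "mult_group Q"
  using P semifieldD(1)[OF Q] by (auto simp: coefficient_group_def)

lemma h_1: "h 1 = 1"
  using h_mult[of 1 1] h_in[of 1] mult_group mult_group_1[of P] mult_group_nonzero[of Q "h 1"] by auto

lemma val_in: "val a u \<Longrightarrow> u \<in> Q"
  by (induction rule: positive_value.induct) (auto intro: semifieldD[OF Q] h_in)

text \<open>For two terms this is multiplicativity of \<open>h\<close> and of monomials. Sums in
  either factor are then expanded in the field and, by the distributive law of \<open>Q\<close>, in
  the values.\<close>

lemma val_mult:
  assumes a: "val a u" and b: "val b v"
  shows "val (a * b) (u * v)"
  using a
proof (induction rule: positive_value.induct)
  case (single p m)
  show ?case using b
  proof (induction rule: positive_value.induct)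
    case (single q m')
    then have "val ((p * q) * monomial x (m + m')) (h (p * q))"
      using \<open>p \<in> P\<close> mult_group by (intro positive_value.single mult_group_mult)
    then show ?case using \<open>p \<in> P\<close> single by (simp add: monomial_add mult_ac h_mult)
  next
    case (add a u b v)
    then have "val (p * monomial x m * a + p * monomial x m * b) (add (h p * u) (h p * v))"
      by (intro positive_value.add)
    then show ?case
      using add \<open>p \<in> P\<close> by (simp add: distrib_left semifieldD(5)[OF Q] val_in h_in)
  qed
next
  case (add a u c w)
  then have "val (a * b + c * b) (add (u * v) (w * v))"
    by (intro positive_value.add)
  moreover have "add u w * v = add (u * v) (w * v)"
    using add b semifieldD(5)[OF Q] by (simp add: mult.commute[of _ v] val_in)
  ultimately show ?case by (simp add: distrib_right)
qed

text \<open>A derivation of \<open>val a u\<close> fixes an order and a bracketing of the sum; the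
  multiset forgets both. By \<open>terms_inject\<close> it depends on \<open>a\<close> alone, and
  hence so does \<open>u\<close>.\<close>

lemma val_terms:
  assumes "val a u"
  shows "\<exists>A. A \<noteq> {#} \<and> fst ` set_mset A \<subseteq> P \<and> a = (\<Sum>(p, m)\<in>#A. p * monomial x m) \<and>
    u = semifield_sum Q add (image_mset (\<lambda>q. h (fst q)) A)"
  using assms
proof (induction rule: positive_value.induct)
  case (single p m)
  then show ?case by (intro exI[of _ "{#(p, m)#}"]) (simp add: semifield_sum_single[OF Q])
next
  case (add a u b v)
  then obtain A B where
    A: "A \<noteq> {#}" "fst ` set_mset A \<subseteq> P" "a = (\<Sum>(p, m)\<in>#A. p * monomial x m)"
      "u = semifield_sum Q add (image_mset (\<lambda>q. h (fst q)) A)" and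
    B: "B \<noteq> {#}" "fst ` set_mset B \<subseteq> P" "b = (\<Sum>(p, m)\<in>#B. p * monomial x m)"
      "v = semifield_sum Q add (image_mset (\<lambda>q. h (fst q)) B)"
    by blast
  have "set_mset (image_mset (\<lambda>q. h (fst q)) A) \<subseteq> Q" "set_mset (image_mset (\<lambda>q. h (fst q)) B) \<subseteq> Q"
    using A(2) B(2) h_in by auto
  then show ?case
    using A B by (intro exI[of _ "A + B"]) (auto simp: semifield_sum_union[OF Q])
qed

lemma terms_inject:
  assumes "fst ` set_mset A \<subseteq> P" "fst ` set_mset B \<subseteq> P"
    "(\<Sum>(p, m)\<in>#A. p * monomial x m) = (\<Sum>(p, m)\<in>#B. p * monomial x m)"
  shows "A = B"
  using P x assms
  by (intro term_multiset_inject[of P x]) (auto simp: coefficient_group_def freely_generates_def)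

lemma val_functional: "val a u \<Longrightarrow> val a v \<Longrightarrow> u = v"
  using val_terms[of a u] val_terms[of a v] terms_inject by metis

text \<open>By uniqueness of the terms, \<open>0\<close> is only the empty sum, whereas values
  belong to nonempty sums.\<close>

lemma val_nonzero:
  assumes "val a u"
  shows "a \<noteq> 0"
proof
  assume "a = 0"
  with val_terms[OF assms] obtain A where "A \<noteq> {#}" "fst ` set_mset A \<subseteq> P"
    "(\<Sum>(p, m)\<in>#A. p * monomial x m) = 0" by auto
  then show False using terms_inject[of A "{#}"] by simp
qed

lemma val_coeff: "p \<in> P \<Longrightarrow> val p (h p)"
  using positive_value.single[of p P h add x 0] by simp

lemma val_var: "val (x i) 1"
  using positive_value.single[of 1 P h add x "Poly_Mapping.single i 1"] mult_group
  by (simp add: monomial_single mult_group_1 h_1)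

text \<open>The graph of the specialization on quotients. Cross-multiplication and
  \<open>val_functional\<close> make it independent of the chosen fraction.\<close>

definition frac_val :: "'f \<Rightarrow> 'g \<Rightarrow> bool" where
  "frac_val z w \<longleftrightarrow> (\<exists>a u b v. val a u \<and> val b v \<and> z = a / b \<and> w = u / v)"

lemma val_imp_frac_val: "val a u \<Longrightarrow> frac_val a u"
  using val_coeff[of 1] mult_group(1) mult_group_1[of P] h_1
  unfolding frac_val_def by fastforce

lemma frac_val_in: "frac_val z w \<Longrightarrow> w \<in> Q"
  using mult_group by (auto simp: frac_val_def intro!: mult_group_divide dest: val_in)

lemma frac_val_nonzero: "frac_val z w \<Longrightarrow> z \<noteq> 0"
  by (auto simp: frac_val_def val_nonzero)

lemma val_value_nonzero: "val a u \<Longrightarrow> u \<noteq> 0"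
  using val_in mult_group(2) mult_group_nonzero by blast

lemma frac_val_functional:
  assumes "frac_val z w" "frac_val z w'"
  shows "w = w'"
proof -
  obtain a u b v a' u' b' v' where
    *: "val a u" "val b v" "z = a / b" "w = u / v" "val a' u'" "val b' v'" "z = a' / b'" "w' = u' / v'"
    using assms unfolding frac_val_def by blast
  then have "a * b' = a' * b" by (auto simp: frac_eq_eq dest!: val_nonzero)
  then have "u * v' = u' * v"
    using val_functional[OF val_mult[OF *(1,6)], of "u' * v"] val_mult[OF *(5,2)] by simp
  then show ?thesis using * by (auto simp: frac_eq_eq dest!: val_value_nonzero)
qed

lemma frac_val_mult:
  assumes "frac_val y u" "frac_val z v"
  shows "frac_val (y * z) (u * v)"
proof -
  obtain a s b t c q d r where
    *: "val a s" "val b t" "y = a / b" "u = s / t" "val c q" "val d r" "z = c / d" "v = q / r"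
    using assms unfolding frac_val_def by blast
  show ?thesis
    unfolding frac_val_def
    by (rule exI[of _ "a * c"], rule exI[of _ "s * q"], rule exI[of _ "b * d"], rule exI[of _ "t * r"])
       (simp add: * val_mult)
qed

lemma frac_val_divide:
  assumes "frac_val y u" "frac_val z v"
  shows "frac_val (y / z) (u / v)"
proof -
  obtain a s b t c q d r where
    *: "val a s" "val b t" "y = a / b" "u = s / t" "val c q" "val d r" "z = c / d" "v = q / r"
    using assms unfolding frac_val_def by blast
  show ?thesis
    unfolding frac_val_def
    by (rule exI[of _ "a * d"], rule exI[of _ "s * r"], rule exI[of _ "b * c"], rule exI[of _ "t * q"])
       (simp add: * val_mult)
qed

lemma frac_val_add:
  assumes "frac_val y u" "frac_val z v"
  shows "frac_val (y + z) (add u v)"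
proof -
  obtain a s b t c q d r where
    *: "val a s" "val b t" "y = a / b" "u = s / t" "val c q" "val d r" "z = c / d" "v = q / r"
    using assms unfolding frac_val_def by blast
  have "val (a * d + c * b) (add (s * r) (q * t))" "val (b * d) (t * r)"
    using * by (auto intro: positive_value.add val_mult)
  moreover have "y + z = (a * d + c * b) / (b * d)"
    using * by (auto simp: add_frac_eq dest!: val_nonzero)
  moreover have "add u v = add (s * r) (q * t) / (t * r)"
  proof -
    have "t \<noteq> 0" "r \<noteq> 0" using * val_value_nonzero by auto
    \<comment> \<open>\<open>add\<close> is not the addition of the field, so the common denominator
      is reached by the distributive law of \<open>Q\<close>, with \<open>inverse (t * r)\<close> as
      the common factor.\<close>
    then have eq: "u = inverse (t * r) * (s * r)" "v = inverse (t * r) * (q * t)"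
      using * by (auto simp: field_simps)
    have "inverse (t * r) \<in> Q" "s * r \<in> Q" "q * t \<in> Q"
      using * mult_group by (auto intro!: mult_group_mult mult_group_inverse simp del: inverse_mult_distrib dest: val_in)
    then show ?thesis
      unfolding eq by (subst semifieldD(5)[OF Q, symmetric]) (auto simp: divide_inverse mult_ac)
  qed
  ultimately show ?thesis unfolding frac_val_def by blast
qed

lemma subtraction_free_frac_val: "z \<in> subtraction_free P x \<Longrightarrow> \<exists>w. frac_val z w"
  by (induction rule: subtraction_free.induct)
     (blast intro: frac_val_add frac_val_mult frac_val_divide val_imp_frac_val val_coeff val_var)+

lemma zero_notin_subtraction_free: "0 \<notin> subtraction_free P x"
  using subtraction_free_frac_val frac_val_nonzero by blast

lemma hom_exists:
  "\<exists>s. semifield_hom (subtraction_free P x) (+) Q add s \<and> (\<forall>i. s (x i) = 1) \<and> (\<forall>p\<in>P. s p = h p)"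
proof (intro exI conjI allI ballI)
  let ?s = "\<lambda>z. THE w. frac_val z w"
  have s: "?s z = w" if "frac_val z w" for z w
    using that frac_val_functional by blast
  show "?s (x i) = 1" for i
    by (intro s val_imp_frac_val val_var)
  show "?s p = h p" if "p \<in> P" for p
    using that by (intro s val_imp_frac_val val_coeff)
  have frac_s: "frac_val z (?s z)" if "z \<in> subtraction_free P x" for z
    using subtraction_free_frac_val[OF that] s by auto
  show "semifield_hom (subtraction_free P x) (+) Q add ?s"
    unfolding semifield_hom_def
    using frac_s by (auto intro!: s frac_val_mult frac_val_add intro: frac_val_in)
qed

end

lemma specialization_exists:
  assumes "coefficient_group P" "semifield P add" "freely_generates P x"
  shows "is_specialization P add x (specialization P add x)"
proof -
  interpret coefficient_hom P P add "\<lambda>p. p" x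
    using assms by unfold_locales auto
  show ?thesis
    using hom_exists unfolding specialization_def is_specialization_def by (rule someI_ex)
qed

text \<open>The trivial homomorphism onto the one-element semifield shows that there is no zero.\<close>

lemma mult_group_subtraction_free:
  assumes "coefficient_group P" "freely_generates P x"
  shows "mult_group (subtraction_free P x)"
proof -
  interpret coefficient_hom P "{1 :: 'a}" "\<lambda>_ _. 1" "\<lambda>_. 1" x
    using assms by unfold_locales (auto simp: semifield_def mult_group_def)
  have 1: "1 \<in> subtraction_free P x"
    using mult_group(1) mult_group_1 subtraction_free.coeff by blast
  then show ?thesis
    using subtraction_free.div[OF 1]
    by (auto simp: mult_group_def inverse_eq_divide zero_notin_subtraction_free intro: subtraction_free.mult)
qed

section \<open>Mutation of non-normalized seeds\<close>

lemma skew_symmetrizable_diag: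
  assumes "skew_symmetrizable B"
  shows "B $ k $ k = 0"
proof -
  obtain d :: "'a \<Rightarrow> int" where "d k > 0" "d k * B $ k $ k = - (d k * B $ k $ k)"
    using assms unfolding skew_symmetrizable_def by blast
  then show ?thesis by simp
qed

lemma skew_symmetrizable_sgn:
  assumes "skew_symmetrizable B"
  shows "sgn (B $ j $ i) = - sgn (B $ i $ j)"
proof -
  obtain d :: "'a \<Rightarrow> int" where d: "\<And>i. d i > 0" "\<And>i j. d i * B $ i $ j = - (d j * B $ j $ i)"
    using assms unfolding skew_symmetrizable_def by blast
  have "sgn (d i * B $ i $ j) = - sgn (d j * B $ j $ i)" by (subst d(2)) (simp add: sgn_if)
  then show ?thesis using d(1)[of i] d(1)[of j] by (simp add: sgn_mult)
qed

definition mutate_matrix :: "'n::finite \<Rightarrow> int ^ 'n ^ 'n \<Rightarrow> int ^ 'n ^ 'n" where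
  "mutate_matrix k B = (\<chi> i j. if i = k \<or> j = k then - B $ i $ j
     else B $ i $ j + sgn (B $ i $ k) * max (B $ i $ k * B $ k $ j) 0)"

lemma mutate_matrix_involution: "mutate_matrix k (mutate_matrix k B) = B"
  by (simp add: mutate_matrix_def vec_eq_iff sgn_minus)

text \<open>The same symmetrizer \<open>d\<close> works. In the correction terms, the scaled
  products are symmetric in \<open>i\<close> and \<open>j\<close>, and the signs in front are
  opposite whenever the product is positive.\<close>

lemma skew_symmetrizable_mutate_matrix:
  assumes B: "skew_symmetrizable B"
  shows "skew_symmetrizable (mutate_matrix k B)"
proof -
  obtain d :: "'a \<Rightarrow> int" where d: "\<And>i. d i > 0" "\<And>i j. d i * B $ i $ j = - (d j * B $ j $ i)"
    using B unfolding skew_symmetrizable_def by blast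
  have corr: "d i * (sgn (B $ i $ k) * max (B $ i $ k * B $ k $ j) 0) =
      - (d j * (sgn (B $ j $ k) * max (B $ j $ k * B $ k $ i) 0))" for i j
  proof -
    \<comment> \<open>Skew-symmetrizability is used from \<open>i\<close> to \<open>k\<close> and
      from \<open>k\<close> to \<open>j\<close>; the two sign changes cancel.\<close>
    have "d i * (B $ i $ k * B $ k $ j) = (d i * B $ i $ k) * B $ k $ j" by simp
    also have "\<dots> = - (d k * B $ k $ j) * B $ k $ i" by (subst d(2)) simp
    also have "\<dots> = d j * (B $ j $ k * B $ k $ i)" by (subst d(2)[of k j]) simp
    finally have eq: "d i * (B $ i $ k * B $ k $ j) = d j * (B $ j $ k * B $ k $ i)" .
    have max_eq: "d i * max (B $ i $ k * B $ k $ j) 0 = d j * max (B $ j $ k * B $ k $ i) 0"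
    proof -
      have "d i * max (B $ i $ k * B $ k $ j) 0 = max (d i * (B $ i $ k * B $ k $ j)) 0"
        using d(1)[of i] by (simp add: max_mult_distrib_left)
      also have "\<dots> = d j * max (B $ j $ k * B $ k $ i) 0"
        using d(1)[of j] unfolding eq by (simp add: max_mult_distrib_left)
      finally show ?thesis .
    qed
    show ?thesis
    proof (cases "B $ i $ k * B $ k $ j > 0")
      case True
      then have "sgn (B $ i $ k) = sgn (B $ k $ j)" by (auto simp: zero_less_mult_iff)
      then have "sgn (B $ i $ k) = - sgn (B $ j $ k)"
        using skew_symmetrizable_sgn[OF B, of j k] by simp
      then have "d i * (sgn (B $ i $ k) * max (B $ i $ k * B $ k $ j) 0) =
          - sgn (B $ j $ k) * (d i * max (B $ i $ k * B $ k $ j) 0)" by simp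
      then show ?thesis unfolding max_eq by simp
    next
      case False
      then have "max (B $ i $ k * B $ k $ j) 0 = 0" by simp
      moreover from this have "max (B $ j $ k * B $ k $ i) 0 = 0"
        using max_eq d(1)[of j] by simp
      ultimately show ?thesis by simp
    qed
  qed
  have "d i * mutate_matrix k B $ i $ j = - (d j * mutate_matrix k B $ j $ i)" for i j
    using d(2)[of i j] corr[of i j] by (auto simp: mutate_matrix_def distrib_left)
  then show ?thesis
    unfolding skew_symmetrizable_def using d(1) by blast
qed

section \<open>Free generation under rescaling and exchange\<close>

lemma generated_field_zero: "0 \<in> generated_field A"
  using generated_field.diff[OF generated_field.one generated_field.one] by simp

lemma generated_field_add: "a \<in> generated_field A \<Longrightarrow> b \<in> generated_field A \<Longrightarrow> a + b \<in> generated_field A"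
  using generated_field.diff[of a A "0 - b"] generated_field.diff[OF generated_field_zero, of b] by simp

lemma generated_field_divide: "a \<in> generated_field A \<Longrightarrow> b \<in> generated_field A \<Longrightarrow> a / b \<in> generated_field A"
  by (simp add: divide_inverse generated_field.mult generated_field.inv)

lemma generated_field_power_int: "a \<in> generated_field A \<Longrightarrow> a powi n \<in> generated_field A"
proof -
  have "b ^ m \<in> generated_field A" if "b \<in> generated_field A" for b m
    using that by (induction m) (auto intro: generated_field.intros)
  then show "a \<in> generated_field A \<Longrightarrow> a powi n \<in> generated_field A"
    by (simp add: power_int_def generated_field.inv)
qed

lemma generated_field_prod: "(\<And>i. i \<in> I \<Longrightarrow> f i \<in> generated_field A) \<Longrightarrow> prod f I \<in> generated_field A"
  by (induction I rule: infinite_finite_induct) (auto intro: generated_field.intros)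

lemma generated_field_subset:
  assumes "A \<subseteq> generated_field B"
  shows "generated_field A \<subseteq> generated_field B"
proof
  show "a \<in> generated_field B" if "a \<in> generated_field A" for a
    using that assms by induction (auto intro: generated_field.intros)
qed

lemma freely_generates_rescale:
  assumes P: "coefficient_group P" and x: "freely_generates P x" and c: "\<And>i. c i \<in> P"
  shows "freely_generates P (\<lambda>i. c i * x i)"
proof -
  note mP = coefficient_group_mult_group[OF P]
  have c0: "c i \<noteq> 0" for i using c mult_group_nonzero[OF mP] by blast
  have "x i \<in> generated_field (P \<union> range (\<lambda>i. c i * x i))" for i
    using generated_field_divide[of "c i * x i" "P \<union> range (\<lambda>i. c i * x i)" "c i"] c c0
    by (auto intro: generated_field.base)
  then have "P \<union> range x \<subseteq> generated_field (P \<union> range (\<lambda>i. c i * x i))"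
    by (auto intro: generated_field.base)
  from generated_field_subset[OF this] x show ?thesis
    using algebraically_independent_rescale[OF subring_group_ring[OF mP], of x c] c c0
    by (auto simp: freely_generates_def intro: rat_vec.span_base)
qed

text \<open>As \<open>b k = 0\<close>, the right-hand side is a polynomial \<open>M\<close> without
  \<open>x k\<close>, so independence passes to \<open>x'\<close>. The relation can also be solved
  for \<open>x k\<close> in terms of \<open>x'\<close>, which gives generation.\<close>

lemma freely_generates_exchange:
  fixes x x' :: "'n::finite \<Rightarrow> 'f::field_char_0"
  assumes P: "coefficient_group P" and x: "freely_generates P x" and pq: "p \<in> P" "q \<in> P"
    and k: "b k = 0" and x': "\<And>j. j \<noteq> k \<Longrightarrow> x' j = x j"
    and exch: "x k * x' k = p * (\<Prod>j\<in>UNIV. x j powi max (b j) 0) + q * (\<Prod>j\<in>UNIV. x j powi max (- b j) 0)"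
      (is "_ = ?E x")
  shows "freely_generates P x'"
proof -
  note mP = coefficient_group_mult_group[OF P]
  have R: "subring (group_ring P)" using mP by (rule subring_group_ring)
  have sf: "mult_group (subtraction_free P x)"
    using P x by (rule mult_group_subtraction_free)
  \<comment> \<open>The exchange polynomial does not vanish because it is subtraction-free.\<close>
  have "?E x \<in> subtraction_free P x"
    using sf pq
    by (intro subtraction_free.add subtraction_free.mult mult_group_prod mult_group_power_int)
       (auto intro: subtraction_free.coeff subtraction_free.var)
  then have E0: "?E x \<noteq> 0" using mult_group_nonzero[OF sf] by blast
  \<comment> \<open>\<open>m 1\<close> and \<open>m (- 1)\<close> are the exponent vectors of the
    two terms; the maximum is nonnegative, so \<open>nat\<close> loses nothing.\<close>
  define m where "m s = Abs_poly_mapping (\<lambda>j. nat (max (s * b j) 0))" for s :: int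
  have lookup_m: "Poly_Mapping.lookup (m s) j = nat (max (s * b j) 0)" for s j
    by (simp add: m_def)
  define M where "M = Poly_Mapping.single (m 1) p + Poly_Mapping.single (m (- 1)) q"
  have M: "M \<in> polys_without k (group_ring P)"
    unfolding M_def using pq
    by (intro polys_without_add polys_without_single R) (auto simp: lookup_m k intro: rat_vec.span_base)
  have eval_M: "poly_eval M x = ?E x"
    by (simp add: M_def poly_eval_add poly_eval_single monomial_def lookup_m power_int_nonneg_exp)
  have "algebraically_independent (group_ring P) x'"
  proof (rule algebraically_independent_exchange[OF R _ M])
    show "algebraically_independent (group_ring P) x" using x by (simp add: freely_generates_def)
    show "poly_eval M x \<noteq> 0" unfolding eval_M by (rule E0)
    show "x k * x' k = poly_eval M x" unfolding eval_M by (rule exch)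
  qed (rule x')
  moreover have "generated_field (P \<union> range x') = UNIV"
  proof -
    let ?G = "generated_field (P \<union> range x')"
    have xk: "x k \<noteq> 0" "x' k \<noteq> 0" using E0 unfolding exch[symmetric] by simp_all
    \<comment> \<open>The variable with index \<open>k\<close> has exponent \<open>0\<close>, so
      both clusters give the same right-hand side.\<close>
    have "x j powi max (s * b j) 0 = x' j powi max (s * b j) 0" for s j
      using k x'[of j] by (cases "j = k") auto
    from this[of _ 1] this[of _ "-1"] have E: "?E x = ?E x'" by simp
    have "?E x' \<in> ?G"
      using pq by (intro generated_field_add generated_field.mult generated_field_prod
          generated_field_power_int) (auto intro: generated_field.base)
    then have "?E x' / x' k \<in> ?G" by (intro generated_field_divide) (auto intro: generated_field.base)
    moreover have "?E x' / x' k = x k" using xk(2) by (simp only: exch[symmetric] E[symmetric]) simp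
    ultimately have "x k \<in> ?G" by simp
    moreover have "x j \<in> ?G" if "j \<noteq> k" for j
      using generated_field.base[of "x' j" "P \<union> range x'"] x'[OF that] by (metis UnI2 rangeI)
    ultimately have "x j \<in> ?G" for j by (cases "j = k") auto
    then have "P \<union> range x \<subseteq> ?G" by (auto intro: generated_field.base)
    from generated_field_subset[OF this] x show ?thesis by (auto simp: freely_generates_def)
  qed
  ultimately show ?thesis by (simp add: freely_generates_def)
qed

section \<open>Mutation equations and their symmetry\<close>

definition exchange_rhs :: "('n::finite, 'f::field) seed \<Rightarrow> 'n \<Rightarrow> 'f" where
  "exchange_rhs S k =
     pplus S k * (\<Prod>j\<in>UNIV. cluster S j powi max (exmat S $ j $ k) 0) +
     pminus S k * (\<Prod>j\<in>UNIV. cluster S j powi max (- exmat S $ j $ k) 0)"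

text \<open>Only the equations of a mutation. They can be checked first, and the seed property of
  the result is then deduced from that of \<open>S\<close> by
  \<open>nn_seed_mutated\<close>.\<close>

definition mutated :: "'n::finite \<Rightarrow> ('n, 'f::field) seed \<Rightarrow> ('n, 'f) seed \<Rightarrow> bool" where
  "mutated k S S' \<longleftrightarrow>
     exmat S' = mutate_matrix k (exmat S) \<and>
     pplus S' k = pminus S k \<and> pminus S' k = pplus S k \<and>
     (\<forall>j. j \<noteq> k \<longrightarrow> ycoeff S' j = ycoeff S j *
        (if exmat S $ k $ j \<ge> 0 then pplus S k else pminus S k) powi (exmat S $ k $ j)) \<and>
     (\<forall>j. j \<noteq> k \<longrightarrow> cluster S' j = cluster S j) \<and>
     cluster S k * cluster S' k = exchange_rhs S k"

lemma mutation_iff_mutated: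
  "mutation P k S S' \<longleftrightarrow> nn_seed P S \<and> nn_seed P S' \<and> mutated k S S'"
  by (simp add: mutation_def mutated_def mutate_matrix_def vec_eq_iff ycoeff_def exchange_rhs_def)

lemma nn_seed_mutated:
  assumes P: "coefficient_group P" and S: "nn_seed P S" and S': "mutated k S S'"
    and p: "\<And>j. pplus S' j \<in> P" "\<And>j. pminus S' j \<in> P"
  shows "nn_seed P S'"
proof -
  have "freely_generates P (cluster S')"
  proof (rule freely_generates_exchange[OF P, where b = "\<lambda>j. exmat S $ j $ k" and k = k])
    show "freely_generates P (cluster S)" "pplus S k \<in> P" "pminus S k \<in> P" "exmat S $ k $ k = 0"
      using S skew_symmetrizable_diag by (auto simp: nn_seed_def)
    show "cluster S' j = cluster S j" if "j \<noteq> k" for j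
      using S' that by (simp add: mutated_def)
    show "cluster S k * cluster S' k =
        pplus S k * (\<Prod>j\<in>UNIV. cluster S j powi max (exmat S $ j $ k) 0) +
        pminus S k * (\<Prod>j\<in>UNIV. cluster S j powi max (- exmat S $ j $ k) 0)"
      using S' by (simp add: mutated_def exchange_rhs_def)
  qed
  then show ?thesis
    using S S' p skew_symmetrizable_mutate_matrix by (auto simp: nn_seed_def mutated_def)
qed

lemma nn_seed_coeff_nonzero:
  assumes "coefficient_group P" "nn_seed P S"
  shows "pplus S j \<noteq> 0" "pminus S j \<noteq> 0"
  using assms mult_group_nonzero coefficient_group_mult_group by (auto simp: nn_seed_def)

lemma nn_seed_cluster_nonzero:
  assumes "coefficient_group P" "nn_seed P S"
  shows "cluster S j \<noteq> 0"
  using mult_group_subtraction_free[OF assms(1), of "cluster S"] assms(2)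
    mult_group_nonzero[OF _ subtraction_free.var[of "cluster S" j P]]
  by (simp add: nn_seed_def)

lemma exchange_rhs_mutated:
  assumes "skew_symmetrizable (exmat S)" "mutated k S S'"
  shows "exchange_rhs S' k = exchange_rhs S k"
proof -
  have "cluster S' j powi max (s * exmat S $ j $ k) 0 = cluster S j powi max (s * exmat S $ j $ k) 0" for j s
    using assms skew_symmetrizable_diag[OF assms(1), of k] by (cases "j = k") (auto simp: mutated_def)
  from this[of _ 1] this[of _ "-1"] show ?thesis
    using assms by (simp add: exchange_rhs_def mutated_def mutate_matrix_def)
qed

text \<open>Row \<open>k\<close> changes sign while the two coefficients with index \<open>k\<close>
  are swapped, so the same factor returns with the opposite exponent. For a zero entry the swap
  selects the other coefficient, but the exponent is \<open>0\<close>.\<close>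

lemma mutated_sym:
  assumes P: "coefficient_group P" and S: "nn_seed P S" and S': "mutated k S S'"
  shows "mutated k S' S"
proof -
  have skew: "skew_symmetrizable (exmat S)" using S by (simp add: nn_seed_def)
  have "ycoeff S j = ycoeff S' j *
      (if exmat S' $ k $ j \<ge> 0 then pplus S' k else pminus S' k) powi (exmat S' $ k $ j)" if "j \<noteq> k" for j
    using S' that nn_seed_coeff_nonzero[OF P S, of k]
    by (cases "exmat S $ k $ j" "0 :: int" rule: linorder_cases)
       (auto simp: mutated_def mutate_matrix_def power_int_minus field_simps)
  then show ?thesis
    using S' exchange_rhs_mutated[OF skew S']
    by (auto simp: mutated_def mutate_matrix_involution mult.commute)
qed

section \<open>Mutation of the hatted variables\<close>

lemma prod_power_int: "(\<Prod>i\<in>A. f i powi n) = (\<Prod>i\<in>A. f i :: 'a::field) powi n"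
  by (induction A rule: infinite_finite_induct) (auto simp: power_int_mult_distrib)

lemma yhat_mutated_same:
  assumes skew: "skew_symmetrizable (exmat S)" and S': "mutated k S S'"
  shows "yhat S' k = inverse (yhat S k)"
proof -
  have "cluster S' i powi (exmat S' $ i $ k) = inverse (cluster S i powi (exmat S $ i $ k))" for i
    using S' skew_symmetrizable_diag[OF skew, of k]
    by (cases "i = k") (auto simp: mutated_def mutate_matrix_def power_int_minus)
  then show ?thesis
    using S' by (simp add: yhat_def mutated_def prod_inversef[symmetric] o_def divide_inverse)
qed

lemma powi_max_divide: "a \<noteq> 0 \<Longrightarrow> a powi max n 0 / a powi max (- n) 0 = (a :: 'a::field) powi n"
  by (simp flip: power_int_diff) (simp add: max_def)

lemma prod_powi_max_divide:
  assumes "\<And>i. i \<in> I \<Longrightarrow> f i \<noteq> (0 :: 'a::field)"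
  shows "(\<Prod>i\<in>I. f i powi n i) = (\<Prod>i\<in>I. f i powi max (n i) 0) / (\<Prod>i\<in>I. f i powi max (- n i) 0)"
  using assms by (simp add: powi_max_divide flip: prod_dividef)

text \<open>\<open>yhat S k\<close> is the ratio of the two terms of the exchange polynomial, and
  the second term is factored out.\<close>

lemma exchange_rhs_yhat:
  assumes "\<And>i. cluster S i \<noteq> 0" "pminus S k \<noteq> 0"
  shows "exchange_rhs S k =
    pminus S k * (\<Prod>j\<in>UNIV. cluster S j powi max (- exmat S $ j $ k) 0) * (1 + yhat S k)"
proof -
  define U where "U = (\<Prod>j\<in>UNIV. cluster S j powi max (exmat S $ j $ k) 0)"
  define V where "V = (\<Prod>j\<in>UNIV. cluster S j powi max (- exmat S $ j $ k) 0)"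
  have V: "V \<noteq> 0" using assms by (simp add: V_def)
  have "yhat S k = pplus S k / pminus S k * (U / V)"
    unfolding yhat_def U_def V_def using assms by (subst prod_powi_max_divide) simp_all
  then have "pplus S k * U + pminus S k * V = pminus S k * V * (1 + yhat S k)"
    using V assms by (simp add: field_simps)
  then show ?thesis by (simp add: exchange_rhs_def U_def V_def)
qed

lemma yhat_fractions:
  assumes "\<And>i. cluster S i \<noteq> 0" "pminus S k \<noteq> 0" "exchange_rhs S k \<noteq> 0"
  shows "yhat S k / (1 + yhat S k) =
      pplus S k * (\<Prod>j\<in>UNIV. cluster S j powi max (exmat S $ j $ k) 0) / exchange_rhs S k"
    and "1 / (1 + yhat S k) =
      pminus S k * (\<Prod>j\<in>UNIV. cluster S j powi max (- exmat S $ j $ k) 0) / exchange_rhs S k"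
proof -
  define U where "U = (\<Prod>j\<in>UNIV. cluster S j powi max (exmat S $ j $ k) 0)"
  define V where "V = (\<Prod>j\<in>UNIV. cluster S j powi max (- exmat S $ j $ k) 0)"
  have E: "exchange_rhs S k = pminus S k * V * (1 + yhat S k)"
    unfolding V_def using assms by (intro exchange_rhs_yhat)
  have nz: "pminus S k * V \<noteq> 0" "1 + yhat S k \<noteq> 0" using assms(3) E by auto
  then show *: "1 / (1 + yhat S k) = pminus S k * V / exchange_rhs S k"
    unfolding E by simp
  have "pplus S k * U + pminus S k * V = exchange_rhs S k"
    by (simp add: exchange_rhs_def U_def V_def)
  then have "pplus S k * U = pminus S k * V * yhat S k"
    unfolding E by (simp add: distrib_left)
  then show "yhat S k / (1 + yhat S k) = pplus S k * U / exchange_rhs S k"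
    using nz unfolding E by simp
qed

text \<open>The coefficient rule with the two coefficients replaced by the fractions of
  \<open>yhat S k\<close>, as identities in the field. Its image under \<open>c\<close> becomes the
  coefficient mutation of the normalized pattern.\<close>

lemma yhat_mutated_other:
  assumes skew: "skew_symmetrizable (exmat S)" and S': "mutated k S S'" and j: "j \<noteq> k"
    and nz: "\<And>i. cluster S i \<noteq> 0" "pminus S k \<noteq> 0" "cluster S' k \<noteq> 0"
  shows "yhat S' j = yhat S j *
    (if exmat S $ k $ j \<ge> 0 then yhat S k / (1 + yhat S k) else 1 / (1 + yhat S k)) powi (exmat S $ k $ j)"
proof -
  let ?x = "cluster S" and ?b = "exmat S"
  define \<beta> where "\<beta> = ?b $ k $ j"
  \<comment> \<open>The exponents of the exchange term selected by the sign of
    \<open>\<beta>\<close>. With this choice the correction in the matrix mutation is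
    \<open>e i * \<beta>\<close> for either sign.\<close>
  define e where "e i = (if \<beta> \<ge> 0 then max (?b $ i $ k) 0 else max (- ?b $ i $ k) 0)" for i
  define p where "p = (if \<beta> \<ge> 0 then pplus S k else pminus S k)"
  have kk: "?b $ k $ k = 0" using skew by (rule skew_symmetrizable_diag)
  have E: "?x k * cluster S' k = exchange_rhs S k" using S' by (simp add: mutated_def)
  then have E0: "exchange_rhs S k \<noteq> 0" using nz by (metis mult_eq_0_iff)
  have e: "sgn (?b $ i $ k) * max (?b $ i $ k * \<beta>) 0 = e i * \<beta>" for i
    by (auto simp: e_def sgn_if max_def mult_le_0_iff zero_le_mult_iff)
  define W where "W = (\<Prod>i\<in>UNIV-{k}. ?x i powi (?b $ i $ j))"
  define U where "U = (\<Prod>i\<in>UNIV. ?x i powi e i)"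
  have U: "U = (\<Prod>i\<in>UNIV-{k}. ?x i powi e i)"
    unfolding U_def by (subst prod.remove[of _ k]) (auto simp: e_def kk)
  have "(\<Prod>i\<in>UNIV. cluster S' i powi (exmat S' $ i $ j)) =
      cluster S' k powi (- \<beta>) * (\<Prod>i\<in>UNIV-{k}. ?x i powi (?b $ i $ j + e i * \<beta>))"
    using S' j
    by (subst prod.remove[of _ k]) (auto simp: mutated_def mutate_matrix_def e[unfolded \<beta>_def] \<beta>_def intro!: prod.cong)
  also have "(\<Prod>i\<in>UNIV-{k}. ?x i powi (?b $ i $ j + e i * \<beta>)) = W * U powi \<beta>"
    using nz by (simp add: power_int_add power_int_mult prod.distrib prod_power_int W_def U)
  finally have "yhat S' j = ycoeff S j * p powi \<beta> * (cluster S' k powi (- \<beta>) * (W * U powi \<beta>))"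
    using S' j by (simp add: yhat_def mutated_def ycoeff_def \<beta>_def p_def)
  \<comment> \<open>A power of \<open>?x k\<close> is inserted and divided out: it completes
    \<open>W\<close> to the product in \<open>yhat S j\<close>, and it turns the denominator into
    the exchange polynomial.\<close>
  also have "\<dots> = ycoeff S j * (?x k powi \<beta> * W) * (p * U / (?x k * cluster S' k)) powi \<beta>"
    using nz by (simp add: power_int_minus power_int_mult_distrib power_int_divide_distrib field_simps)
  also have "ycoeff S j * (?x k powi \<beta> * W) = yhat S j"
    unfolding yhat_def W_def \<beta>_def ycoeff_def by (subst (2) prod.remove[of _ k]) auto
  also have "p * U / (?x k * cluster S' k) =
      (if \<beta> \<ge> 0 then yhat S k / (1 + yhat S k) else 1 / (1 + yhat S k))"
    using yhat_fractions[of S k] nz E0 by (simp add: E p_def U_def e_def)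
  finally show ?thesis by (simp add: \<beta>_def)
qed

section \<open>Rescaling by contractible sequences of mutations\<close>

text \<open>One representative among the possible results of a mutation: away from \<open>k\<close>
  only ratios are prescribed, and the minus coefficients are set to \<open>1\<close>.\<close>

definition mutate_seed :: "'n::finite \<Rightarrow> ('n, 'f::field) seed \<Rightarrow> ('n, 'f) seed" where
  "mutate_seed k S =
     \<lparr>exmat = mutate_matrix k (exmat S),
      pplus = (\<lambda>j. if j = k then pminus S k else ycoeff S j *
        (if exmat S $ k $ j \<ge> 0 then pplus S k else pminus S k) powi (exmat S $ k $ j)),
      pminus = (\<lambda>j. if j = k then pplus S k else 1),
      cluster = (\<lambda>j. if j = k then exchange_rhs S k / cluster S k else cluster S j)\<rparr>"

lemma mutation_mutate_seed:
  assumes P: "coefficient_group P" and S: "nn_seed P S"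
  shows "mutation P k S (mutate_seed k S)"
proof -
  note mP = coefficient_group_mult_group[OF P]
  have mut: "mutated k S (mutate_seed k S)"
    using nn_seed_cluster_nonzero[OF P S, of k] by (simp add: mutated_def mutate_seed_def ycoeff_def)
  have p: "pplus S j \<in> P" "pminus S j \<in> P" for j using S by (auto simp: nn_seed_def)
  have "nn_seed P (mutate_seed k S)"
    using p mult_group_1[OF mP]
    by (intro nn_seed_mutated[OF P S mut])
       (auto simp: mutate_seed_def ycoeff_def intro!: mult_group_mult mult_group_divide mult_group_power_int mP)
  then show ?thesis using S mut by (simp add: mutation_iff_mutated)
qed

lemma mutation_sym: "coefficient_group P \<Longrightarrow> mutation P k S S' \<Longrightarrow> mutation P k S' S"
  using mutated_sym by (auto simp: mutation_iff_mutated)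

lemma tree_walk_append:
  "tree_walk T t (ks @ ls) t' \<longleftrightarrow> (\<exists>s. tree_walk T t ks s \<and> tree_walk T s ls t')"
  by (induction ks arbitrary: t) auto

lemma mutation_sequence_append:
  "mutation_sequence P ks S S' \<Longrightarrow> mutation_sequence P ls S' S'' \<Longrightarrow> mutation_sequence P (ks @ ls) S S''"
  by (induction ks arbitrary: S) auto

text \<open>
  Unlike in \<^const>\<open>seed_equiv\<close>, the walk must be closed from every vertex. This is an equivalent
  requirement, but only this form is evidently preserved under concatenation.
\<close>

definition closed_mutation ::
  "('t \<Rightarrow> 'n::finite \<Rightarrow> 't \<Rightarrow> bool) \<Rightarrow> 'f::field_char_0 set \<Rightarrow>
   ('n, 'f) seed \<Rightarrow> ('n, 'f) seed \<Rightarrow> bool" where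
  "closed_mutation T P S S' \<longleftrightarrow> (\<exists>ks. (\<forall>t. tree_walk T t ks t) \<and> mutation_sequence P ks S S')"

lemma closed_mutation_imp_seed_equiv: "closed_mutation T P S S' \<Longrightarrow> seed_equiv T P S S'"
  by (auto simp: closed_mutation_def seed_equiv_def contractible_def)

lemma closed_mutation_refl: "nn_seed P S \<Longrightarrow> closed_mutation T P S S"
  unfolding closed_mutation_def by (rule exI[of _ "[]"]) simp

lemma closed_mutation_trans:
  "closed_mutation T P S S' \<Longrightarrow> closed_mutation T P S' S'' \<Longrightarrow> closed_mutation T P S S''"
  unfolding closed_mutation_def using tree_walk_append mutation_sequence_append by metis

text \<open>An edge is traversed back by its own label, so a closed walk inserted at its far end
  gives a closed walk.\<close>

lemma closed_mutation_conjugate: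
  assumes T: "labeled_regular_tree T"
    and S: "mutation P k S S1" "closed_mutation T P S1 S2" "mutation P k S2 S'"
  shows "closed_mutation T P S S'"
proof -
  obtain ks where ks: "\<And>t. tree_walk T t ks t" "mutation_sequence P ks S1 S2"
    using S(2) by (auto simp: closed_mutation_def)
  have "tree_walk T t ([k] @ ks @ [k]) t" for t
  proof -
    obtain s where "T t k s" "T s k t" using T unfolding labeled_regular_tree_def by metis
    then show ?thesis using ks(1)[of s] by (auto simp: tree_walk_append simp del: append.simps)
  qed
  moreover have "mutation_sequence P [k] S S1" "mutation_sequence P [k] S2 S'"
    using S by (auto simp: mutation_iff_mutated)
  then have "mutation_sequence P ([k] @ ks @ [k]) S S'"
    using ks(2) by (intro mutation_sequence_append)
  ultimately show ?thesis unfolding closed_mutation_def by blast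
qed

lemma nn_seed_ycoeff_change:
  assumes "nn_seed P S" "exmat S' = exmat S" "cluster S' = cluster S"
    "\<And>j. pplus S' j \<in> P" "\<And>j. pminus S' j \<in> P"
  shows "nn_seed P S'"
  using assms by (simp add: nn_seed_def)

text \<open>
  Mutating back and forth in direction \<open>k\<close> rescales the coefficients with index different from
  \<open>k\<close>, since a mutation only prescribes their ratios.
\<close>

lemma closed_mutation_same_ycoeff_except:
  assumes T: "labeled_regular_tree T" and P: "coefficient_group P"
    and S: "nn_seed P S" and S': "nn_seed P S'"
    and eq: "exmat S' = exmat S" "cluster S' = cluster S" "ycoeff S' = ycoeff S"
      "pplus S' k = pplus S k" "pminus S' k = pminus S k"
  shows "closed_mutation T P S S'"
proof -
  \<comment> \<open>Of its source, \<open>mutated k\<close> sees only the matrix, the cluster, the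
    ratios and the coefficients with index \<open>k\<close>. Hence \<open>S\<close> and
    \<open>S'\<close> share a mutation.\<close>
  have "mutated k S' (mutate_seed k S)"
    using mutation_mutate_seed[OF P S, of k] eq
    by (simp add: mutation_iff_mutated mutated_def exchange_rhs_def)
  then have "mutation P k S' (mutate_seed k S)"
    using mutation_mutate_seed[OF P S, of k] S' by (simp add: mutation_iff_mutated)
  then show ?thesis
    using mutation_mutate_seed[OF P S, of k] closed_mutation_conjugate[OF T] mutation_sym[OF P]
      closed_mutation_refl[of P "mutate_seed k S"] by (metis mutation_iff_mutated)
qed

text \<open>Direction \<open>k\<close> adjusts all coefficient pairs but the one with index
  \<open>k\<close>, which a second direction \<open>l\<close> adjusts; this is where rank at least 2
  enters.\<close>

lemma closed_mutation_same_ycoeff: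
  assumes T: "labeled_regular_tree T" and P: "coefficient_group P" and card: "CARD('n::finite) \<ge> 2"
    and S: "nn_seed P (S :: ('n, 'f::field_char_0) seed)" and S': "nn_seed P S'"
    and eq: "exmat S' = exmat S" "cluster S' = cluster S" "ycoeff S' = ycoeff S"
  shows "closed_mutation T P S S'"
proof -
  obtain k l :: 'n where kl: "k \<noteq> l"
    using card by (metis One_nat_def Suc_1 UNIV_I card_le_Suc0_iff_eq finite not_less_eq_eq)
  define S1 where "S1 = S\<lparr>pplus := (pplus S')(k := pplus S k), pminus := (pminus S')(k := pminus S k)\<rparr>"
  have p: "pplus S1 j / pminus S1 j = ycoeff S j" for j
    using eq(3) by (auto simp: S1_def ycoeff_def fun_eq_iff)
  have "pplus S1 j \<in> P" "pminus S1 j \<in> P" for j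
    using S S' by (auto simp: S1_def nn_seed_def)
  then have S1: "nn_seed P S1"
    by (intro nn_seed_ycoeff_change[OF S]) (auto simp: S1_def)
  have y: "ycoeff S1 = ycoeff S" using p by (auto simp: ycoeff_def)
  have "closed_mutation T P S S1"
    using y by (intro closed_mutation_same_ycoeff_except[OF T P S S1, of k]) (auto simp: S1_def)
  moreover have "closed_mutation T P S1 S'"
    using y eq kl by (intro closed_mutation_same_ycoeff_except[OF T P S1 S', of l]) (auto simp: S1_def)
  ultimately show ?thesis by (rule closed_mutation_trans)
qed

text \<open>
  Rescaling the coefficients \<open>p'\<^sub>k\<close> of a seed mutated in direction \<open>k\<close> and then mutating back
  rescales \<open>x\<^sub>k\<close>.
\<close>

lemma closed_mutation_rescale_one:
  assumes T: "labeled_regular_tree T" and P: "coefficient_group P" and card: "CARD('n::finite) \<ge> 2"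
    and S: "nn_seed P (S :: ('n, 'f::field_char_0) seed)" and S': "nn_seed P S'" and e: "e \<in> P"
    and eq: "exmat S' = exmat S" "cluster S' = (cluster S)(k := cluster S k / e)"
      "\<And>j. ycoeff S' j = ycoeff S j * e powi (exmat S $ k $ j)"
  shows "closed_mutation T P S S'"
proof -
  note mP = coefficient_group_mult_group[OF P]
  have e0: "e \<noteq> 0" using mult_group_nonzero[OF mP e] .
  have p: "pplus S j \<in> P" "pminus S j \<in> P" for j using S by (auto simp: nn_seed_def)
  have skew: "skew_symmetrizable (exmat S)" using S by (simp add: nn_seed_def)
  note kk = skew_symmetrizable_diag[OF skew, of k]
  define S1 where "S1 = mutate_seed k S"
  \<comment> \<open>\<open>S2\<close> has the ratios of \<open>S1\<close>, so a closed walk reaches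
    it. Mutating it back yields \<open>S3\<close>, whose pair with index \<open>k\<close> is forced
    by \<open>S2\<close>. The ratio of this pair is that of \<open>S'\<close> because the diagonal
    entry is \<open>0\<close>, so \<open>S3\<close> and \<open>S'\<close> differ only by a rescaling
    of coefficient pairs.\<close>
  define S2 where "S2 = S1\<lparr>pplus := (pplus S1)(k := pplus S1 k / e), pminus := (pminus S1)(k := pminus S1 k / e)\<rparr>"
  define S3 where "S3 = S'\<lparr>pplus := (pplus S')(k := pplus S k / e), pminus := (pminus S')(k := pminus S k / e)\<rparr>"
  have SS1: "mutation P k S S1" unfolding S1_def using P S by (rule mutation_mutate_seed)
  then have S1: "nn_seed P S1" "mutated k S S1" by (simp_all add: mutation_iff_mutated)
  have S1S: "mutated k S1 S" using mutated_sym[OF P S S1(2)] .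
  have p23: "pplus S2 j \<in> P" "pminus S2 j \<in> P" "pplus S3 j \<in> P" "pminus S3 j \<in> P" for j
    using S S' S1 e by (auto simp: S2_def S3_def nn_seed_def intro!: mult_group_divide[OF mP])
  have S2: "nn_seed P S2"
    by (rule nn_seed_ycoeff_change[OF S1(1)]) (use p23 in \<open>simp_all add: S2_def\<close>)
  have S3: "nn_seed P S3"
    by (rule nn_seed_ycoeff_change[OF S']) (use p23 in \<open>simp_all add: S3_def\<close>)
  have y2: "ycoeff S2 = ycoeff S1" using e0 by (auto simp: S2_def ycoeff_def)
  have y3: "ycoeff S3 = ycoeff S'"
    using e0 eq(3)[of k] kk by (auto simp: S3_def ycoeff_def)
  have "closed_mutation T P S1 S2"
    by (rule closed_mutation_same_ycoeff[OF T P card S1(1) S2]) (auto simp: S2_def y2[unfolded S2_def])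
  moreover have "mutated k S2 S3"
  proof -
    have "ycoeff S3 j = ycoeff S2 j *
        (if exmat S2 $ k $ j \<ge> 0 then pplus S2 k else pminus S2 k) powi (exmat S2 $ k $ j)" if "j \<noteq> k" for j
    proof -
      have "exmat S1 $ k $ j = - exmat S $ k $ j"
        using S1(2) by (simp add: mutated_def mutate_matrix_def)
      moreover have "ycoeff S j = ycoeff S1 j *
          (if exmat S1 $ k $ j \<ge> 0 then pplus S1 k else pminus S1 k) powi (exmat S1 $ k $ j)"
        using S1S that by (simp add: mutated_def)
      ultimately show ?thesis
        using e0 unfolding y2 y3 eq(3)
        by (simp add: S2_def power_int_divide_distrib power_int_minus field_simps)
    qed
    moreover have "exchange_rhs S2 k = exchange_rhs S1 k / e"
      by (simp add: exchange_rhs_def S2_def add_divide_distrib)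
    moreover have "cluster S2 k * cluster S3 k = cluster S1 k * cluster S k / e"
      using eq by (simp add: S2_def S3_def)
    moreover have "exmat S3 = mutate_matrix k (exmat S2)" "cluster S1 k * cluster S k = exchange_rhs S1 k"
      "pplus S3 k = pminus S2 k" "pminus S3 k = pplus S2 k" "\<forall>j. j \<noteq> k \<longrightarrow> cluster S3 j = cluster S2 j"
      using S1S eq by (auto simp: S2_def S3_def mutated_def)
    ultimately show ?thesis by (auto simp: mutated_def)
  qed
  then have "mutation P k S2 S3" using S2 S3 by (simp add: mutation_iff_mutated)
  ultimately have "closed_mutation T P S S3" by (rule closed_mutation_conjugate[OF T SS1])
  moreover have "closed_mutation T P S3 S'"
    by (rule closed_mutation_same_ycoeff[OF T P card S3 S']) (auto simp: S3_def y3[unfolded S3_def])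
  ultimately show ?thesis by (rule closed_mutation_trans)
qed

text \<open>The cluster variables are rescaled one index at a time. The factors \<open>d j\<close>
  cancel in the ratios and are absorbed by \<open>closed_mutation_same_ycoeff\<close>.\<close>

lemma seed_rescaling_imp_seed_equiv:
  assumes T: "labeled_regular_tree T" and P: "coefficient_group P" and card: "CARD('n::finite) \<ge> 2"
    and resc: "seed_rescaling P (S :: ('n, 'f::field_char_0) seed) S'"
  shows "seed_equiv T P S S'"
proof -
  note mP = coefficient_group_mult_group[OF P]
  obtain c d where S: "nn_seed P S" and S': "nn_seed P S'" and B: "exmat S' = exmat S"
    and c: "\<And>j. c j \<in> P" and d: "\<And>j. d j \<in> P"
    and x: "\<And>j. cluster S' j = cluster S j / c j"
    and pplus: "\<And>j. pplus S' j = pplus S j / d j * (\<Prod>i\<in>UNIV. c i powi max (exmat S $ i $ j) 0)"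
    and pminus: "\<And>j. pminus S' j = pminus S j / d j * (\<Prod>i\<in>UNIV. c i powi max (- exmat S $ i $ j) 0)"
    using resc unfolding seed_rescaling_def by (auto simp: image_subset_iff)
  have c0: "c j \<noteq> 0" and d0: "d j \<noteq> 0" for j using c d mult_group_nonzero[OF mP] by auto
  \<comment> \<open>The intermediate seed with the variables in \<open>I\<close> already rescaled.
    Its coefficient pairs are reduced to a ratio and \<open>1\<close>, so only the ratios have to be
    followed.\<close>
  define R where "R I = \<lparr>exmat = exmat S,
      pplus = (\<lambda>j. ycoeff S j * (\<Prod>i\<in>I. c i powi (exmat S $ i $ j))), pminus = (\<lambda>j. 1),
      cluster = (\<lambda>j. inverse (if j \<in> I then c j else 1) * cluster S j)\<rparr>" for I
  have R: "nn_seed P (R I)" for I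
  proof -
    have "freely_generates P (cluster (R I))"
      using S c mult_group_1[OF mP] unfolding R_def seed.simps nn_seed_def
      by (intro freely_generates_rescale[OF P]) (auto intro: mult_group_inverse[OF mP])
    moreover have "pplus (R I) j \<in> P" for j
      using S c by (auto simp: R_def ycoeff_def nn_seed_def
        intro!: mult_group_mult[OF mP] mult_group_divide[OF mP] mult_group_prod[OF mP] mult_group_power_int[OF mP])
    ultimately show ?thesis
      using S mult_group_1[OF mP] by (auto simp: nn_seed_def) (auto simp: R_def)
  qed
  have "closed_mutation T P S (R I)" for I
    using finite[of I]
  proof induction
    case empty
    show ?case
      by (rule closed_mutation_same_ycoeff[OF T P card S R]) (auto simp: R_def ycoeff_def)
  next
    case (insert k I)
    have "closed_mutation T P (R I) (R (insert k I))"
      using insert.hyps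
      by (intro closed_mutation_rescale_one[OF T P card R R c[of k], where k = k])
         (auto simp: R_def ycoeff_def divide_inverse mult_ac)
    with insert.IH show ?case by (rule closed_mutation_trans)
  qed
  moreover have "closed_mutation T P (R UNIV) S'"
  proof (rule closed_mutation_same_ycoeff[OF T P card R S'])
    show "ycoeff S' = ycoeff (R UNIV)"
    proof
      fix j
      show "ycoeff S' j = ycoeff (R UNIV) j"
        using d0[of j] prod_powi_max_divide[of UNIV c "\<lambda>i. exmat S $ i $ j"] c0
        by (simp add: R_def ycoeff_def pplus pminus)
    qed
  qed (auto simp: R_def B x divide_inverse mult_ac)
  ultimately show ?thesis
    using closed_mutation_imp_seed_equiv closed_mutation_trans by blast
qed

section \<open>Seed patterns\<close>

text \<open>The multiplicative rules common to \<open>\<Psi>\<close> and \<open>c\<close>, whose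
  target semifields have different additions.\<close>

locale mult_group_hom =
  fixes A :: "'f::field set" and h :: "'f \<Rightarrow> 'g::field"
  assumes group: "mult_group A"
    and mult: "\<And>a b. a \<in> A \<Longrightarrow> b \<in> A \<Longrightarrow> h (a * b) = h a * h b"
    and nonzero: "\<And>a. a \<in> A \<Longrightarrow> h a \<noteq> 0"
begin

lemma one [simp]: "h 1 = 1"
  using mult[of 1 1] nonzero[of 1] mult_group_1[OF group] by simp

lemma inverse:
  assumes "a \<in> A"
  shows "h (inverse a) = inverse (h a)"
proof -
  have "h a * h (inverse a) = 1"
    using assms by (simp add: mult_group_inverse[OF group] mult_group_nonzero[OF group] flip: mult)
  then show ?thesis by (simp add: inverse_unique)
qed

lemma divide: "a \<in> A \<Longrightarrow> b \<in> A \<Longrightarrow> h (a / b) = h a / h b"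
  by (simp add: divide_inverse mult inverse mult_group_inverse[OF group])

lemma power_int: "a \<in> A \<Longrightarrow> h (a powi n) = h a powi n"
proof -
  have "h (b ^ m) = h b ^ m" if "b \<in> A" for b m
    using that mult_group_power_int[OF group that, of "int _"]
    by (induction m) (auto simp: mult)
  then show "a \<in> A \<Longrightarrow> h (a powi n) = h a powi n"
    using mult_group_inverse[OF group] by (simp add: power_int_def inverse)
qed

lemma prod: "(\<And>i. i \<in> I \<Longrightarrow> f i \<in> A) \<Longrightarrow> h (prod f I) = (\<Prod>i\<in>I. h (f i))"
  by (induction I rule: infinite_finite_induct) (auto simp: mult mult_group_prod[OF group])

end

lemma mult_group_hom_semifield_hom:
  assumes "semifield_hom A add B add' h" "mult_group A" "mult_group B"
  shows "mult_group_hom A h"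
  using assms by unfold_locales (auto simp: semifield_hom_def mult_group_def)

text \<open>The property is carried along the path from \<open>t0\<close> to
  \<open>t\<close>.\<close>

lemma labeled_regular_tree_induct:
  assumes T: "labeled_regular_tree T" and base: "Q t0"
    and step: "\<And>t k t'. T t k t' \<Longrightarrow> Q t \<Longrightarrow> Q t'"
  shows "Q t"
proof -
  have "Q (last ts)" if "successively (\<lambda>s s'. \<exists>k. T s k s') ts" "ts \<noteq> []" "Q (hd ts)" for ts
    using that
  proof (induction ts)
    case (Cons s ts)
    then show ?case by (cases ts) (auto dest: step)
  qed simp
  moreover obtain ts where "tree_path T t0 ts t"
    using T unfolding labeled_regular_tree_def by blast
  ultimately show ?thesis using base unfolding tree_path_def by metis
qed

lemma subtraction_free_subset:
  assumes "range x \<subseteq> subtraction_free P y"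
  shows "subtraction_free P x \<subseteq> subtraction_free P y"
proof
  fix a
  assume "a \<in> subtraction_free P x"
  then show "a \<in> subtraction_free P y"
  proof (induction rule: subtraction_free.induct)
    case (coeff p)
    then show ?case by (rule subtraction_free.coeff)
  next
    case (var i)
    show ?case using assms by (rule subsetD) simp
  next
    case (add a b)
    show ?case using add.IH by (rule subtraction_free.add)
  next
    case (mult a b)
    show ?case using mult.IH by (rule subtraction_free.mult)
  next
    case (div a b)
    show ?case using div.IH by (rule subtraction_free.div)
  qed
qed

lemma exchange_rhs_subtraction_free:
  assumes P: "coefficient_group P" and S: "nn_seed P S"
  shows "exchange_rhs S k \<in> subtraction_free P (cluster S)"
proof -
  have A: "mult_group (subtraction_free P (cluster S))"
    using S by (intro mult_group_subtraction_free[OF P]) (simp add: nn_seed_def)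
  have "pplus S k \<in> subtraction_free P (cluster S)" "pminus S k \<in> subtraction_free P (cluster S)"
    using S by (auto simp: nn_seed_def intro: subtraction_free.coeff)
  then show ?thesis
    unfolding exchange_rhs_def
    by (intro subtraction_free.add subtraction_free.mult mult_group_prod[OF A]
        mult_group_power_int[OF A] subtraction_free.var)
qed

text \<open>The exchange relation expresses the new variable without subtraction by the old ones;
  the reverse inclusion is the same fact for the inverse mutation.\<close>

lemma subtraction_free_mutation:
  assumes P: "coefficient_group P" and mut: "mutation P k S S'"
  shows "subtraction_free P (cluster S') = subtraction_free P (cluster S)"
proof -
  have "subtraction_free P (cluster S') \<subseteq> subtraction_free P (cluster S)" if "mutation P k S S'" for S S'
  proof (rule subtraction_free_subset, clarify)
    fix j
    have S: "nn_seed P S" "mutated k S S'" using that by (simp_all add: mutation_iff_mutated)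
    have "cluster S' k = exchange_rhs S k / cluster S k"
      using S nn_seed_cluster_nonzero[OF P S(1), of k] by (simp add: mutated_def field_simps)
    moreover have "cluster S' j = cluster S j" if "j \<noteq> k"
      using S(2) that by (simp add: mutated_def)
    moreover have "exchange_rhs S k / cluster S k \<in> subtraction_free P (cluster S)"
      by (intro subtraction_free.div subtraction_free.var exchange_rhs_subtraction_free[OF P S(1)])
    ultimately show "cluster S' j \<in> subtraction_free P (cluster S)"
      using subtraction_free.var[of "cluster S" j P] by (cases "j = k") simp_all
  qed
  from this[OF mut] this[OF mutation_sym[OF P mut]] show ?thesis by blast
qed

lemma ambient_semifield_eq:
  assumes "nn_seed_pattern T P \<Sigma>"
  shows "ambient_semifield P \<Sigma> = subtraction_free P (cluster (\<Sigma> t))"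
proof -
  have "subtraction_free P (cluster (\<Sigma> s)) = subtraction_free P (cluster (\<Sigma> t))" for s
  proof (rule labeled_regular_tree_induct[where T = T and ?t0.0 = t and
      Q = "\<lambda>s. subtraction_free P (cluster (\<Sigma> s)) = subtraction_free P (cluster (\<Sigma> t))"])
    show "labeled_regular_tree T" using assms by (simp add: nn_seed_pattern_def)
  next
    fix r k r' assume "T r k r'" and r: "subtraction_free P (cluster (\<Sigma> r)) = subtraction_free P (cluster (\<Sigma> t))"
    then have "coefficient_group P" and "mutation P k (\<Sigma> r) (\<Sigma> r')"
      using assms unfolding nn_seed_pattern_def by blast+
    then show "subtraction_free P (cluster (\<Sigma> r')) = subtraction_free P (cluster (\<Sigma> t))"
      using subtraction_free_mutation r by blast
  qed simp
  then show ?thesis by (auto simp: ambient_semifield_def)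
qed

section \<open>Normalization along a semifield homomorphism\<close>

locale semifield_pattern_hom =
  fixes T :: "'t \<Rightarrow> 'n::finite \<Rightarrow> 't \<Rightarrow> bool"
    and P :: "'f::field_char_0 set"
    and \<Sigma> :: "'t \<Rightarrow> ('n, 'f) seed"
    and t0 :: 't
    and Pbar :: "'g::field_char_0 set"
    and oplus :: "'g \<Rightarrow> 'g \<Rightarrow> 'g"
    and xbar :: "'n \<Rightarrow> 'g"
    and \<Psi> c :: "'f \<Rightarrow> 'g"
  assumes pattern: "nn_seed_pattern T P \<Sigma>"
    and Pbar: "semifield Pbar oplus" "coefficient_group Pbar"
    and xbar: "freely_generates Pbar xbar"
    and \<Psi>_hom: "semifield_hom (ambient_semifield P \<Sigma>) (+) (subtraction_free Pbar xbar) (+) \<Psi>"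
    and \<Psi>_coeff: "\<Psi> ` P \<subseteq> Pbar"
    and \<Psi>_cluster: "\<And>i. \<Psi> (cluster (\<Sigma> t0) i) / xbar i \<in> Pbar"
    and c: "c = specialization Pbar oplus xbar \<circ> \<Psi>"
begin

section \<open>The homomorphisms \<open>\<Psi>\<close> and \<open>c\<close> on the ambient
  semifield\<close>

abbreviation A :: "'f set" where "A \<equiv> ambient_semifield P \<Sigma>"

lemma P: "coefficient_group P" and nn_seed: "nn_seed P (\<Sigma> t)"
    and mutation: "T t k t' \<Longrightarrow> mutation P k (\<Sigma> t) (\<Sigma> t')" and tree: "labeled_regular_tree T"
  using pattern by (auto simp: nn_seed_pattern_def)

lemma A_eq: "A = subtraction_free P (cluster (\<Sigma> t))"
  using pattern by (rule ambient_semifield_eq)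

lemma group_A: "mult_group A"
  using nn_seed[of t0] P unfolding A_eq[of t0]
  by (intro mult_group_subtraction_free) (auto simp: nn_seed_def)

lemma group_sf: "mult_group (subtraction_free Pbar xbar)"
  using Pbar(2) xbar by (rule mult_group_subtraction_free)

lemma group_Pbar: "mult_group Pbar"
  using Pbar(1) by (rule semifieldD)

lemma spec: "is_specialization Pbar oplus xbar (specialization Pbar oplus xbar)"
  using Pbar(2,1) xbar by (rule specialization_exists)

lemma c_hom: "semifield_hom A (+) Pbar oplus c"
  using \<Psi>_hom spec unfolding semifield_hom_def is_specialization_def c
  by (auto simp: image_subset_iff)

sublocale Psi: mult_group_hom A \<Psi>
  using \<Psi>_hom group_A group_sf by (rule mult_group_hom_semifield_hom)

sublocale cc: mult_group_hom A c
  using c_hom group_A group_Pbar by (rule mult_group_hom_semifield_hom)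

lemma \<Psi>_add: "a \<in> A \<Longrightarrow> b \<in> A \<Longrightarrow> \<Psi> (a + b) = \<Psi> a + \<Psi> b"
  using \<Psi>_hom by (simp add: semifield_hom_def)

lemma c_add: "a \<in> A \<Longrightarrow> b \<in> A \<Longrightarrow> c (a + b) = oplus (c a) (c b)"
  and c_in: "a \<in> A \<Longrightarrow> c a \<in> Pbar"
  using c_hom by (auto simp: semifield_hom_def)

lemma in_A:
  shows coeff_in_A: "p \<in> P \<Longrightarrow> p \<in> A" and cluster_in_A: "cluster (\<Sigma> t) i \<in> A"
    and pplus_in_A: "pplus (\<Sigma> t) i \<in> A" and pminus_in_A: "pminus (\<Sigma> t) i \<in> A"
  using nn_seed[of t] unfolding A_eq[of t]
  by (auto intro: subtraction_free.coeff subtraction_free.var simp: nn_seed_def)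

lemma add_in_A: "a \<in> A \<Longrightarrow> b \<in> A \<Longrightarrow> a + b \<in> A"
  unfolding A_eq[of t0] by (rule subtraction_free.add)

lemma power_prod_in_A: "(\<Prod>i\<in>I. cluster (\<Sigma> t) i powi n i) \<in> A"
  by (intro mult_group_prod[OF group_A] mult_group_power_int[OF group_A] cluster_in_A)

lemma yhat_in_A: "yhat (\<Sigma> t) j \<in> A"
  unfolding yhat_def
  by (intro mult_group_mult[OF group_A] mult_group_divide[OF group_A] power_prod_in_A in_A)

lemma one_yhat_in_A: "1 + yhat (\<Sigma> t) j \<in> A"
  by (intro add_in_A yhat_in_A mult_group_1[OF group_A])

lemma yhat_frac_in_A: "yhat (\<Sigma> t) j / (1 + yhat (\<Sigma> t) j) \<in> A" "1 / (1 + yhat (\<Sigma> t) j) \<in> A"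
  by (intro mult_group_divide[OF group_A] yhat_in_A one_yhat_in_A mult_group_1[OF group_A])+

lemma c_coeff: "p \<in> P \<Longrightarrow> c p = \<Psi> p"
  using \<Psi>_coeff spec by (auto simp: c is_specialization_def)

text \<open>The fractions are formed before \<open>c\<close> is applied, so normalization and the
  mutation rules become images of identities in the ambient semifield.\<close>

definition nseed :: "'t \<Rightarrow> ('n, 'g) seed" where
  "nseed t =
     \<lparr>exmat = exmat (\<Sigma> t),
      pplus = (\<lambda>j. c (yhat (\<Sigma> t) j / (1 + yhat (\<Sigma> t) j))),
      pminus = (\<lambda>j. c (1 / (1 + yhat (\<Sigma> t) j))),
      cluster = (\<lambda>i. \<Psi> (cluster (\<Sigma> t) i) / c (cluster (\<Sigma> t) i))\<rparr>"

lemma nseed_simps [simp]: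
  "exmat (nseed t) = exmat (\<Sigma> t)"
  "pplus (nseed t) j = c (yhat (\<Sigma> t) j / (1 + yhat (\<Sigma> t) j))"
  "pminus (nseed t) j = c (1 / (1 + yhat (\<Sigma> t) j))"
  "cluster (nseed t) i = \<Psi> (cluster (\<Sigma> t) i) / c (cluster (\<Sigma> t) i)"
  by (simp_all add: nseed_def)

section \<open>Coefficients, hatted variables and exchange polynomials of the new seeds\<close>

lemma nseed_normalized: "oplus (pplus (nseed t) j) (pminus (nseed t) j) = 1"
proof -
  let ?y = "yhat (\<Sigma> t) j"
  have "?y / (1 + ?y) + 1 / (1 + ?y) = 1"
    using one_yhat_in_A[of t j] mult_group_nonzero[OF group_A] by (simp flip: add_divide_distrib add: add.commute)
  then show ?thesis using c_add[OF yhat_frac_in_A(1)[of t j] yhat_frac_in_A(2)[of t j]] by simp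
qed

lemma ycoeff_nseed: "ycoeff (nseed t) j = c (yhat (\<Sigma> t) j)"
  using one_yhat_in_A[of t j]
  by (simp add: ycoeff_def cc.divide[OF yhat_in_A] cc.divide[OF mult_group_1[OF group_A]]
      cc.nonzero)

lemma nseed_power_prod:
  "(\<Prod>i\<in>I. cluster (nseed t) i powi n i) =
    \<Psi> (\<Prod>i\<in>I. cluster (\<Sigma> t) i powi n i) / c (\<Prod>i\<in>I. cluster (\<Sigma> t) i powi n i)"
  by (simp add: Psi.prod cc.prod Psi.power_int cc.power_int cluster_in_A
      mult_group_power_int[OF group_A] power_int_divide_distrib prod_dividef)

lemma Psi_eq_c_ratio: "\<Psi> (pplus (\<Sigma> t) j / pminus (\<Sigma> t) j) = c (pplus (\<Sigma> t) j / pminus (\<Sigma> t) j)"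
proof -
  have "pplus (\<Sigma> t) j / pminus (\<Sigma> t) j \<in> P"
    using nn_seed[of t] coefficient_group_mult_group[OF P] by (auto simp: nn_seed_def intro: mult_group_divide)
  then show ?thesis by (simp add: c_coeff)
qed

text \<open>\<open>\<Psi>\<close> and \<open>c\<close> agree on coefficients, and the value of
  \<open>c\<close> on the cluster monomial cancels the denominators of the new cluster.\<close>

lemma yhat_nseed: "yhat (nseed t) j = \<Psi> (yhat (\<Sigma> t) j)"
proof -
  let ?r = "pplus (\<Sigma> t) j / pminus (\<Sigma> t) j" and ?X = "\<Prod>i\<in>UNIV. cluster (\<Sigma> t) i powi (exmat (\<Sigma> t) $ i $ j)"
  have A: "?r \<in> A" "?X \<in> A"
    by (intro mult_group_divide[OF group_A] in_A power_prod_in_A)+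
  have "yhat (nseed t) j = c (?r * ?X) * (\<Psi> ?X / c ?X)"
    using ycoeff_nseed[of t j] nseed_power_prod[of t _ UNIV] by (simp add: yhat_def ycoeff_def)
  also have "\<dots> = \<Psi> ?r * \<Psi> ?X"
    unfolding cc.mult[OF A] Psi_eq_c_ratio using cc.nonzero[OF A(2)] by simp
  also have "\<dots> = \<Psi> (yhat (\<Sigma> t) j)"
    unfolding yhat_def Psi.mult[OF A] ..
  finally show ?thesis .
qed

lemma cluster_nseed_nonzero: "cluster (nseed t) i \<noteq> 0"
  using Psi.nonzero[OF cluster_in_A] cc.nonzero[OF cluster_in_A] by simp

text \<open>Both sides are factored by \<open>exchange_rhs_yhat\<close>. The old coefficient
  \<open>pminus\<close> can be inserted in numerator and denominator because \<open>\<Psi>\<close>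
  and \<open>c\<close> agree on it.\<close>

lemma exchange_rhs_nseed: "exchange_rhs (nseed t) k = \<Psi> (exchange_rhs (\<Sigma> t) k) / c (exchange_rhs (\<Sigma> t) k)"
proof -
  let ?y = "yhat (\<Sigma> t) k" and ?p = "pminus (\<Sigma> t) k"
    and ?V = "\<Prod>i\<in>UNIV. cluster (\<Sigma> t) i powi max (- exmat (\<Sigma> t) $ i $ k) 0"
  have A: "?p \<in> A" "?V \<in> A" "?p * ?V \<in> A" "1 + ?y \<in> A"
    by (intro mult_group_mult[OF group_A] in_A power_prod_in_A one_yhat_in_A)+
  have "pminus (nseed t) k \<noteq> 0"
    using cc.nonzero[OF yhat_frac_in_A(2)] by simp
  then have "exchange_rhs (nseed t) k = c (1 / (1 + ?y)) * (\<Psi> ?V / c ?V) * (1 + \<Psi> ?y)"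
    using exchange_rhs_yhat[OF cluster_nseed_nonzero, of t k] nseed_power_prod[of t _ UNIV]
    by (simp add: yhat_nseed)
  also have "\<dots> = (\<Psi> ?V / c ?V) * (\<Psi> (1 + ?y) / c (1 + ?y))"
    using mult_group_1[OF group_A]
    by (simp add: cc.divide A(4) \<Psi>_add yhat_in_A)
  also have "\<dots> = \<Psi> (?p * ?V * (1 + ?y)) / c (?p * ?V * (1 + ?y))"
  proof -
    have "\<Psi> ?p = c ?p" using nn_seed[of t] by (simp add: c_coeff nn_seed_def)
    then show ?thesis
      using cc.nonzero[OF A(1)] by (simp add: Psi.mult cc.mult A)
  qed
  also have "?p * ?V * (1 + ?y) = exchange_rhs (\<Sigma> t) k"
    using nn_seed_cluster_nonzero[OF P nn_seed] nn_seed_coeff_nonzero[OF P nn_seed]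
    by (intro exchange_rhs_yhat[symmetric]) auto
  finally show ?thesis .
qed

section \<open>Mutations and seed property of the new pattern\<close>

lemma mutated_nseed:
  assumes "T t k t'"
  shows "mutated k (nseed t) (nseed t')"
proof -
  have mut: "mutated k (\<Sigma> t) (\<Sigma> t')" using mutation[OF assms] by (simp add: mutation_iff_mutated)
  have skew: "skew_symmetrizable (exmat (\<Sigma> t))" using nn_seed[of t] by (simp add: nn_seed_def)
  let ?y = "yhat (\<Sigma> t) k"
  have y: "?y \<noteq> 0" "1 + ?y \<noteq> 0"
    using mult_group_nonzero[OF group_A] yhat_in_A one_yhat_in_A by blast+
  have y': "yhat (\<Sigma> t') k = inverse ?y" using skew mut by (rule yhat_mutated_same)
  \<comment> \<open>Mutation inverts \<open>yhat\<close> at \<open>k\<close>, which swaps the two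
    fractions and hence the two new coefficients.\<close>
  have "inverse ?y / (1 + inverse ?y) = 1 / (1 + ?y)" "1 / (1 + inverse ?y) = ?y / (1 + ?y)"
    using y by (simp_all add: field_simps)
  then have p: "pplus (nseed t') k = pminus (nseed t) k" "pminus (nseed t') k = pplus (nseed t) k"
    by (simp_all add: y')
  have "ycoeff (nseed t') j = ycoeff (nseed t) j *
      (if exmat (nseed t) $ k $ j \<ge> 0 then pplus (nseed t) k else pminus (nseed t) k) powi
        (exmat (nseed t) $ k $ j)" if "j \<noteq> k" for j
  proof -
    let ?q = "if exmat (\<Sigma> t) $ k $ j \<ge> 0 then ?y / (1 + ?y) else 1 / (1 + ?y)"
    have q: "?q \<in> A" using yhat_frac_in_A[of t k] by simp
    have "yhat (\<Sigma> t') j = yhat (\<Sigma> t) j * ?q powi (exmat (\<Sigma> t) $ k $ j)"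
      using nn_seed_cluster_nonzero[OF P nn_seed] nn_seed_coeff_nonzero[OF P nn_seed]
      by (intro yhat_mutated_other[OF skew mut that]) auto
    then have "c (yhat (\<Sigma> t') j) = c (yhat (\<Sigma> t) j) * c ?q powi (exmat (\<Sigma> t) $ k $ j)"
      using cc.mult[OF yhat_in_A mult_group_power_int[OF group_A q]] cc.power_int[OF q] by metis
    then show ?thesis by (simp add: ycoeff_nseed)
  qed
  moreover have "cluster (nseed t) k * cluster (nseed t') k = exchange_rhs (nseed t) k"
  proof -
    have "cluster (\<Sigma> t) k * cluster (\<Sigma> t') k = exchange_rhs (\<Sigma> t) k"
      using mut by (simp add: mutated_def)
    then show ?thesis
      using Psi.mult[OF cluster_in_A[of t k] cluster_in_A[of t' k]]
        cc.mult[OF cluster_in_A[of t k] cluster_in_A[of t' k]]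
      by (simp add: exchange_rhs_nseed)
  qed
  moreover have "exmat (\<Sigma> t') = mutate_matrix k (exmat (\<Sigma> t))"
    "\<forall>j. j \<noteq> k \<longrightarrow> cluster (\<Sigma> t') j = cluster (\<Sigma> t) j"
    using mut by (auto simp: mutated_def)
  ultimately show ?thesis
    using p unfolding mutated_def by simp
qed

text \<open>The specialization sends \<open>xbar i\<close> to \<open>1\<close> and fixes
  \<open>Pbar\<close>, so \<open>c\<close> extracts from the image of the initial variable exactly
  its factor in \<open>Pbar\<close>.\<close>

lemma cluster_nseed_initial: "cluster (nseed t0) = xbar"
proof
  fix i
  let ?q = "\<Psi> (cluster (\<Sigma> t0) i) / xbar i"
  have x0: "xbar i \<noteq> 0" using mult_group_nonzero[OF group_sf subtraction_free.var] .
  note q = \<Psi>_cluster[of i] mult_group_nonzero[OF group_Pbar \<Psi>_cluster[of i]]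
  have "c (cluster (\<Sigma> t0) i) = specialization Pbar oplus xbar (?q * xbar i)"
    using x0 by (simp add: c)
  also have "\<dots> = specialization Pbar oplus xbar ?q * specialization Pbar oplus xbar (xbar i)"
    using spec subtraction_free.coeff[OF q(1)] subtraction_free.var[of xbar i Pbar]
    unfolding is_specialization_def semifield_hom_def by blast
  also have "\<dots> = ?q"
    using spec q(1) by (simp add: is_specialization_def)
  finally show "cluster (nseed t0) i = xbar i" using q(2) x0 by simp
qed

lemma nn_seed_nseed: "nn_seed Pbar (nseed t)"
proof (rule labeled_regular_tree_induct[OF tree, where ?t0.0 = t0 and Q = "\<lambda>t. nn_seed Pbar (nseed t)"])
  have p: "pplus (nseed t) j \<in> Pbar" "pminus (nseed t) j \<in> Pbar" for t j
    using c_in[OF yhat_frac_in_A(1)] c_in[OF yhat_frac_in_A(2)] by simp_all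
  show "nn_seed Pbar (nseed t0)"
    using nn_seed[of t0] p[of t0] xbar unfolding nn_seed_def cluster_nseed_initial by simp
  show "nn_seed Pbar (nseed t')" if "T t k t'" "nn_seed Pbar (nseed t)" for t k t'
    using nn_seed_mutated[OF Pbar(2) that(2) mutated_nseed[OF that(1)]] p by blast
qed

lemma seed_rescaling_nseed: "seed_rescaling Pbar (map_seed \<Psi> (\<Sigma> t)) (nseed t)"
proof -
  let ?x = "cluster (\<Sigma> t)" and ?b = "exmat (\<Sigma> t)"
  let ?c = "\<lambda>i. c (?x i)"
  let ?V = "\<lambda>j. \<Prod>i\<in>UNIV. ?c i powi max (- ?b $ i $ j) 0"
  \<comment> \<open>Solved from the rescaling equation for \<open>pminus\<close>; the equation for
    \<open>pplus\<close> then amounts to the known ratio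
    \<open>c (yhat (\<Sigma> t) j)\<close>.\<close>
  let ?d = "\<lambda>j. \<Psi> (pminus (\<Sigma> t) j) / pminus (nseed t) j * ?V j"
  have x: "?c i \<in> Pbar" "?c i \<noteq> 0" "\<Psi> (?x i) \<noteq> 0" for i
    using c_in[OF cluster_in_A] cc.nonzero[OF cluster_in_A] Psi.nonzero[OF cluster_in_A] by auto
  have pb: "pminus (nseed t) j \<in> Pbar" "pminus (nseed t) j \<noteq> 0" for j
    using nn_seed_nseed[of t] nn_seed_coeff_nonzero[OF Pbar(2) nn_seed_nseed] by (auto simp: nn_seed_def)
  have \<Psi>p: "\<Psi> (pplus (\<Sigma> t) j) \<in> Pbar" "\<Psi> (pminus (\<Sigma> t) j) \<in> Pbar" for j
    using nn_seed[of t] \<Psi>_coeff by (auto simp: nn_seed_def)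
  have \<Psi>p0: "\<Psi> (pminus (\<Sigma> t) j) \<noteq> 0" for j
    using mult_group_nonzero[OF group_Pbar \<Psi>p(2)] .
  have V0: "?V j \<noteq> 0" for j using x by simp
  have "freely_generates Pbar (cluster (nseed t))"
    using nn_seed_nseed[of t] unfolding nn_seed_def by blast
  \<comment> \<open>The image cluster inherits free generation from the new cluster, of which it is
    a rescaling.\<close>
  then have "freely_generates Pbar (\<lambda>i. ?c i * cluster (nseed t) i)"
    using x(1) by (rule freely_generates_rescale[OF Pbar(2)])
  moreover have "(\<lambda>i. ?c i * cluster (nseed t) i) = \<Psi> \<circ> ?x" using x by auto
  ultimately have nn: "nn_seed Pbar (map_seed \<Psi> (\<Sigma> t))"
    using nn_seed[of t] \<Psi>p by (auto simp: nn_seed_def map_seed_def)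
  have d: "?d j \<in> Pbar" for j
    by (intro mult_group_mult[OF group_Pbar] mult_group_divide[OF group_Pbar] \<Psi>p pb
        mult_group_prod[OF group_Pbar] mult_group_power_int[OF group_Pbar] x)
  have "pplus (nseed t) j = \<Psi> (pplus (\<Sigma> t) j) / ?d j * (\<Prod>i\<in>UNIV. ?c i powi max (?b $ i $ j) 0)" for j
  proof -
    have "pplus (nseed t) j = pminus (nseed t) j * c (yhat (\<Sigma> t) j)"
      using ycoeff_nseed[of t j] pb(2)[of j] by (simp add: ycoeff_def field_simps del: nseed_simps)
    also have "c (yhat (\<Sigma> t) j) = c (pplus (\<Sigma> t) j / pminus (\<Sigma> t) j) * c (\<Prod>i\<in>UNIV. ?x i powi (?b $ i $ j))"
      unfolding yhat_def by (intro cc.mult mult_group_divide[OF group_A] in_A power_prod_in_A)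
    also have "c (pplus (\<Sigma> t) j / pminus (\<Sigma> t) j) = \<Psi> (pplus (\<Sigma> t) j) / \<Psi> (pminus (\<Sigma> t) j)"
      unfolding Psi_eq_c_ratio[symmetric] by (intro Psi.divide in_A)
    also have "c (\<Prod>i\<in>UNIV. ?x i powi (?b $ i $ j)) = (\<Prod>i\<in>UNIV. ?c i powi (?b $ i $ j))"
      by (simp add: cc.prod cc.power_int cluster_in_A mult_group_power_int[OF group_A])
    also have "(\<Prod>i\<in>UNIV. ?c i powi (?b $ i $ j)) = (\<Prod>i\<in>UNIV. ?c i powi max (?b $ i $ j) 0) / ?V j"
      using x by (intro prod_powi_max_divide)
    finally show ?thesis using V0[of j] pb(2)[of j] \<Psi>p0[of j] by (simp add: field_simps del: nseed_simps)
  qed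
  moreover have "pminus (nseed t) j = \<Psi> (pminus (\<Sigma> t) j) / ?d j * ?V j" for j
    using V0[of j] pb(2)[of j] \<Psi>p0[of j] by (simp del: nseed_simps)
  ultimately show ?thesis
    unfolding seed_rescaling_def
    using nn nn_seed_nseed[of t] x d
    by (intro conjI exI[of _ ?c] exI[of _ ?d]) (auto simp: map_seed_def simp del: nseed_simps(2,3))
qed

end

theorem proposition4p3:
  fixes T :: "'t \<Rightarrow> 'n::finite \<Rightarrow> 't \<Rightarrow> bool"
    and Tbar :: "'s \<Rightarrow> 'n \<Rightarrow> 's \<Rightarrow> bool"
    and bar :: "'t \<Rightarrow> 's"
    and P :: "'f::field_char_0 set"
    and \<Sigma> :: "'t \<Rightarrow> ('n, 'f) seed"
    and t0 :: 't
    and Pbar :: "'g::field_char_0 set"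
    and oplus :: "'g \<Rightarrow> 'g \<Rightarrow> 'g"
    and xbar :: "'n \<Rightarrow> 'g"
    and \<Psi> c :: "'f \<Rightarrow> 'g"
  assumes pattern: "nn_seed_pattern T P \<Sigma>"
    and second_copy: "labeled_regular_tree Tbar" "labeled_tree_iso T Tbar bar"
    and Pbar: "semifield Pbar oplus" "coefficient_group Pbar"
    and xbar: "freely_generates Pbar xbar"
    and \<Psi>_hom: "semifield_hom (ambient_semifield P \<Sigma>) (+) (subtraction_free Pbar xbar) (+) \<Psi>"
    and \<Psi>_coeff: "\<Psi> ` P \<subseteq> Pbar"
    and \<Psi>_cluster: "\<And>i. \<Psi> (cluster (\<Sigma> t0) i) / xbar i \<in> Pbar"
    and c: "c = specialization Pbar oplus xbar \<circ> \<Psi>"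
  shows "\<exists>\<Sigma>bar :: 's \<Rightarrow> ('n, 'g) seed.
    normalized_seed_pattern Tbar Pbar oplus \<Sigma>bar \<and>
    ambient_semifield Pbar \<Sigma>bar = subtraction_free Pbar xbar \<and>
    (\<forall>t. exmat (\<Sigma>bar (bar t)) = exmat (\<Sigma> t)) \<and>
    (\<forall>t i. cluster (\<Sigma>bar (bar t)) i = \<Psi> (cluster (\<Sigma> t) i) / c (cluster (\<Sigma> t) i)) \<and>
    (\<forall>t i. yhat (\<Sigma>bar (bar t)) i = \<Psi> (yhat (\<Sigma> t) i)) \<and>
    (\<forall>t i. ycoeff (\<Sigma>bar (bar t)) i = c (yhat (\<Sigma> t) i)) \<and>
    (CARD('n) \<ge> 2 \<longrightarrow> quasi_homomorphism T P \<Sigma> Tbar Pbar \<Sigma>bar bar \<Psi>) \<and>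
    (CARD('n) = 1 \<longrightarrow>
       quasi_homomorphism_wrt (seed_rescaling Pbar) T P \<Sigma> Tbar Pbar \<Sigma>bar bar \<Psi>)"
proof -
  interpret semifield_pattern_hom T P \<Sigma> t0 Pbar oplus xbar \<Psi> c
    using pattern Pbar xbar \<Psi>_hom \<Psi>_coeff \<Psi>_cluster c by unfold_locales
  \<comment> \<open>The new seeds live on the second copy of the tree, so they are transported along
    the inverse of \<open>bar\<close>.\<close>
  define \<Sigma>bar where "\<Sigma>bar s = nseed (inv bar s)" for s
  have bar: "bij bar" "\<And>t k t'. T t k t' \<longleftrightarrow> Tbar (bar t) k (bar t')"
    using second_copy(2) by (auto simp: labeled_tree_iso_def)
  have \<Sigma>bar: "\<Sigma>bar (bar t) = nseed t" for t
    using bar(1) by (simp add: \<Sigma>bar_def bij_is_inj)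
  have "mutation Pbar k (\<Sigma>bar s) (\<Sigma>bar s')" if "Tbar s k s'" for s k s'
    using that mutated_nseed[of "inv bar s" k "inv bar s'"] nn_seed_nseed bar
    by (simp add: \<Sigma>bar_def mutation_iff_mutated bij_is_surj surj_f_inv_f)
  then have pattern_bar: "nn_seed_pattern Tbar Pbar \<Sigma>bar"
    using second_copy(1) Pbar(2) nn_seed_nseed by (simp add: nn_seed_pattern_def \<Sigma>bar_def)
  then have normalized: "normalized_seed_pattern Tbar Pbar oplus \<Sigma>bar"
    using Pbar(1) nseed_normalized by (simp add: normalized_seed_pattern_def \<Sigma>bar_def del: nseed_simps)
  have ambient: "ambient_semifield Pbar \<Sigma>bar = subtraction_free Pbar xbar"
    using ambient_semifield_eq[OF pattern_bar, of "bar t0"] by (simp add: \<Sigma>bar cluster_nseed_initial del: nseed_simps)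
  \<comment> \<open>Stated for any relation \<open>R\<close>, to be used both with
    \<open>seed_equiv\<close> and with \<open>seed_rescaling\<close>.\<close>
  have quasi_hom: "quasi_homomorphism_wrt R T P \<Sigma> Tbar Pbar \<Sigma>bar bar \<Psi>"
    if "\<And>t. R (map_seed \<Psi> (\<Sigma> t)) (nseed t)" for R
    using that second_copy(2) \<Psi>_hom \<Psi>_coeff
    by (simp add: quasi_homomorphism_wrt_def ambient \<Sigma>bar)
  have "quasi_homomorphism T P \<Sigma> Tbar Pbar \<Sigma>bar bar \<Psi>" if "CARD('n) \<ge> 2"
    unfolding quasi_homomorphism_def
    by (intro quasi_hom seed_rescaling_imp_seed_equiv[OF second_copy(1) Pbar(2) that] seed_rescaling_nseed)
  moreover have "quasi_homomorphism_wrt (seed_rescaling Pbar) T P \<Sigma> Tbar Pbar \<Sigma>bar bar \<Psi>"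
    by (intro quasi_hom seed_rescaling_nseed)
  ultimately show ?thesis
    using normalized ambient
    by (intro exI[of _ \<Sigma>bar]) (simp add: \<Sigma>bar yhat_nseed ycoeff_nseed)
qed

end
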